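(* Fix integers $d \geq 1$ and $\kappa \geq 1$. Then for all integers $m \geq 0$ and all integers $\alpha \geq 1$, $\boldsymbol{\Theta}_{m,\kappa}(D) \subset \boldsymbol{\Theta}_{m,\alpha\kappa}(D) \subset \boldsymbol{\Theta}_{\alpha\kappa}(D)$.
   Context: Operators. For $d \geq 1$ let $\mathscr{H}=\ell^2(\mathbb{Z}^d)$, let $S_i$ be the shift $(S_i^{\pm 1} u)(n) = u(n_1,\ldots,n_i \mp 1,\ldots,n_d)$, $\Delta_i = \frac12 (S_i + S_i^* )$ and $D=D[d] = \prod_{i=1}^d \Delta_i$ (Molchanov--Vainberg Laplacian); $\sigma(D)=[-1,1]$. Let $(N_i u)(n) = n_i u(n)$. For $j,\kappa \in \mathbb{N}^*=\{1,2,\ldots\}$ let $A_i(j,\kappa)$ be the closure of $\frac{1}{4\mathrm{i}}\left[(S_i^{j\kappa}-S_i^{-j\kappa})N_i + N_i (S_i^{j\kappa}-S_i^{-j\kappa})\right]$ defined on compactly supported sequences, and $A_{j\kappa} = \sum_{i=1}^d A_i(j,\kappa)$ (self-adjoint). Thresholds. $\boldsymbol{\mu}_\kappa(D)$ is the set of $E \in \sigma(D)$ for which there exist a self-adjoint linear combination (finite or infinite) $\mathbb{A} = \sum_{j \geq 1} \rho_{j\kappa} A_{j\kappa}$, $\rho_{j\kappa}\in\mathbb{R}$, an interval $I \ni E$ and $\gamma>0$ with $1_I(D)[D,\mathrm{i}\mathbb{A}]_\circ 1_I(D) \geq \gamma 1_I(D)$, where $[D,\mathrm{i}\mathbb{A}]_\circ$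 is the bounded extension of the commutator from compactly supported sequences. $\boldsymbol{\Theta}_\kappa(D) = \sigma(D)\setminus \boldsymbol{\mu}_\kappa(D)$. Let $U_n$ be the Chebyshev polynomial of the second kind, $U_{n-1}(\cos\theta)=\sin(n\theta)/\sin\theta$. For $\vec{x}=(x_1,\ldots,x_d)\in[-1,1]^d$ let $g_{j\kappa}(\vec{x}) = \sum_{i=1}^d \big(\prod_{l \neq i} x_l\big)(1-x_i^2)U_{j\kappa-1}(x_i)$, and $S_E = \{\vec{x}\in[-1,1]^d : \prod_{l=1}^d x_l = E\}$. The function $G_\kappa = \sum_j \rho_{j\kappa} g_{j\kappa}$ represents $[D,\mathrm{i}\mathbb{A}]_\circ$ by functional calculus (with $\Delta_i \leftrightarrow x_i$), and by continuity of $G_\kappa$, $E\in\boldsymbol{\mu}_\kappa(D)$ iff $G_\kappa>0$ on $S_E$ for some such $\mathbb{A}$. $\boldsymbol{\Theta}_{0,\kappa}(D)$ is the set of $E\in[-1,1]$ such that there is $\vec{x}\in S_E$ with $g_{j\kappa}(\vec{x})=0$ for all $j\in\mathbb{N}^*$. For $m\in\mathbb{N}^*$, $\boldsymbol{\Theta}_{m,\kappa}(D)$ is the set of $E\in[-1,1]$ such that there are $\vec{x}_0,\ldots,\vec{x}_m \in S_E$ and real numbers $\omega_0,\ldots,\omega_{m-1}\leq 0$ with $g_{j\kappa}(\vec{x}_m) = \sum_{q=0}^{m-1}\omega_q\, g_{j\kappa}(\vec{x}_q)$ for all $j\in\mathbb{N}^*$. *)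

theory Defs
  imports "HOL-Analysis.Analysis"
begin

section \<open>The Hilbert space of square-summable families\<close>

definition ell2 :: "('a \<Rightarrow> complex) set" where
  "ell2 = {u. (\<lambda>n. (cmod (u n))\<^sup>2) summable_on UNIV}"

definition ell2_inner :: "('a \<Rightarrow> complex) \<Rightarrow> ('a \<Rightarrow> complex) \<Rightarrow> complex" where
  "ell2_inner u v = (\<Sum>\<^sub>\<infinity>n. cnj (u n) * v n)"

definition ell2_norm :: "('a \<Rightarrow> complex) \<Rightarrow> real" where
  "ell2_norm u = sqrt (\<Sum>\<^sub>\<infinity>n. (cmod (u n))\<^sup>2)"

text \<open>Membership is required explicitly, because \<^term>\<open>infsum\<close> returns \<open>0\<close> on non-summable families.\<close>

definition ell2_tendsto :: "(nat \<Rightarrow> 'a \<Rightarrow> complex) \<Rightarrow> ('a \<Rightarrow> complex) \<Rightarrow> bool" where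
  "ell2_tendsto U u \<longleftrightarrow>
     (\<forall>k. U k \<in> ell2) \<and> u \<in> ell2 \<and> (\<lambda>k. ell2_norm (\<lambda>n. U k n - u n)) \<longlonglongrightarrow> 0"

definition comp_supp :: "('a \<Rightarrow> complex) set" where
  "comp_supp = {u. finite {n. u n \<noteq> 0}}"

section \<open>Operators\<close>

text \<open>A bounded operator is a function that is constrained only on \<^term>\<open>ell2\<close>.\<close>

definition bounded_op :: "(('a \<Rightarrow> complex) \<Rightarrow> ('a \<Rightarrow> complex)) \<Rightarrow> bool" where
  "bounded_op T \<longleftrightarrow>
     (\<forall>u\<in>ell2. T u \<in> ell2) \<and>
     (\<forall>u\<in>ell2. \<forall>v\<in>ell2. \<forall>a b. T (\<lambda>n. a * u n + b * v n) = (\<lambda>n. a * T u n + b * T v n)) \<and>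
     (\<exists>C. \<forall>u\<in>ell2. ell2_norm (T u) \<le> C * ell2_norm u)"

definition spectrum_op :: "(('a \<Rightarrow> complex) \<Rightarrow> ('a \<Rightarrow> complex)) \<Rightarrow> complex set" where
  "spectrum_op T = {z. \<not> (\<exists>R. bounded_op R \<and>
     (\<forall>u\<in>ell2. R (\<lambda>n. T u n - z * u n) = u \<and> (\<lambda>n. T (R u) n - z * R u n) = u))}"

text \<open>\<open>S \<le> T\<close> in the sense of quadratic forms.\<close>

definition op_le ::
  "(('a \<Rightarrow> complex) \<Rightarrow> ('a \<Rightarrow> complex)) \<Rightarrow> (('a \<Rightarrow> complex) \<Rightarrow> ('a \<Rightarrow> complex)) \<Rightarrow> bool" where
  "op_le S T \<longleftrightarrow> (\<forall>u\<in>ell2.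
     ell2_inner u (T u) - ell2_inner u (S u) \<in> \<real> \<and>
     0 \<le> Re (ell2_inner u (T u) - ell2_inner u (S u)))"

text \<open>
  \<open>P\<close> is the projection-valued measure of the bounded self-adjoint operator \<open>T\<close>, that is
  \<open>T = \<integral> t dP(t)\<close> weakly. By the spectral theorem such a \<open>P\<close> exists and is unique (on Borel sets
  and on \<^term>\<open>ell2\<close>); \<open>P M\<close> is then the spectral projection \<open>1\<^sub>M(T)\<close>.
\<close>

definition orth_projection :: "(('a \<Rightarrow> complex) \<Rightarrow> ('a \<Rightarrow> complex)) \<Rightarrow> bool" where
  "orth_projection Q \<longleftrightarrow> bounded_op Q \<and> (\<forall>u\<in>ell2. Q (Q u) = Q u) \<and>
     (\<forall>u\<in>ell2. \<forall>v\<in>ell2. ell2_inner (Q u) v = ell2_inner u (Q v))"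

definition scalar_spectral_measure ::
  "(real set \<Rightarrow> ('a \<Rightarrow> complex) \<Rightarrow> ('a \<Rightarrow> complex)) \<Rightarrow> ('a \<Rightarrow> complex) \<Rightarrow> real measure" where
  "scalar_spectral_measure P u =
     measure_of UNIV (sets borel) (\<lambda>M. ennreal ((ell2_norm (P M u))\<^sup>2))"

definition spectral_measure ::
  "(('a \<Rightarrow> complex) \<Rightarrow> ('a \<Rightarrow> complex)) \<Rightarrow> (real set \<Rightarrow> ('a \<Rightarrow> complex) \<Rightarrow> ('a \<Rightarrow> complex)) \<Rightarrow> bool"
where
  "spectral_measure T P \<longleftrightarrow>
     (\<forall>M\<in>sets borel. orth_projection (P M)) \<and>
     (\<forall>u\<in>ell2. P UNIV u = u) \<and>
     (\<forall>M :: nat \<Rightarrow> real set. range M \<subseteq> sets borel \<longrightarrow> disjoint_family M \<longrightarrow>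
        (\<forall>u\<in>ell2. ell2_tendsto (\<lambda>K n. \<Sum>k<K. P (M k) u n) (P (\<Union>k. M k) u))) \<and>
     (\<forall>u\<in>ell2. integrable (scalar_spectral_measure P u) (\<lambda>t. t) \<and>
        ell2_inner u (T u) = complex_of_real (\<integral>t. t \<partial>scalar_spectral_measure P u))"

text \<open>Unbounded operators are represented by their graphs.\<close>

definition op_closure ::
  "(('a \<Rightarrow> complex) \<times> ('a \<Rightarrow> complex)) set \<Rightarrow> (('a \<Rightarrow> complex) \<times> ('a \<Rightarrow> complex)) set" where
  "op_closure H = {(u, v). \<exists>U V. (\<forall>k. (U k, V k) \<in> H) \<and> ell2_tendsto U u \<and> ell2_tendsto V v}"

definition op_adjoint ::
  "(('a \<Rightarrow> complex) \<times> ('a \<Rightarrow> complex)) set \<Rightarrow> (('a \<Rightarrow> complex) \<times> ('a \<Rightarrow> complex)) set" where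
  "op_adjoint H = {(u, v). u \<in> ell2 \<and> v \<in> ell2 \<and>
     (\<forall>(x, y)\<in>H. ell2_inner u y = ell2_inner v x)}"

definition densely_defined :: "(('a \<Rightarrow> complex) \<times> ('a \<Rightarrow> complex)) set \<Rightarrow> bool" where
  "densely_defined H \<longleftrightarrow> (\<forall>u\<in>ell2. \<exists>U. (\<forall>k. U k \<in> Domain H) \<and> ell2_tendsto U u)"

definition selfadjoint :: "(('a \<Rightarrow> complex) \<times> ('a \<Rightarrow> complex)) set \<Rightarrow> bool" where
  "selfadjoint H \<longleftrightarrow> densely_defined H \<and> op_adjoint H = H"

section \<open>The Molchanov--Vainberg Laplacian and the conjugate operators\<close>

type_synonym 'd lattice_fun = "int ^ 'd \<Rightarrow> complex"

text \<open>The integer power \<open>S\<^sub>i\<^sup>k\<close>; its adjoint is \<open>S\<^sub>i\<close> to the power \<open>-k\<close>.\<close>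

definition shift :: "'d::finite \<Rightarrow> int \<Rightarrow> 'd lattice_fun \<Rightarrow> 'd lattice_fun" where
  "shift i k u = (\<lambda>n. u (n - axis i k))"

definition Delta :: "'d::finite \<Rightarrow> 'd lattice_fun \<Rightarrow> 'd lattice_fun" where
  "Delta i u = (\<lambda>n. (shift i 1 u n + shift i (-1) u n) / 2)"

text \<open>The composition of all \<open>\<Delta>\<^sub>i\<close>, in any order since they commute.\<close>

definition MV_D :: "'d::finite lattice_fun \<Rightarrow> 'd lattice_fun" where
  "MV_D u = Finite_Set.fold Delta u UNIV"

lemma Delta_commute: "Delta i (Delta j u) = Delta j (Delta i u)"
  by (auto simp: Delta_def shift_def fun_eq_iff algebra_simps add_divide_distrib)

lemma comp_fun_commute_Delta: "comp_fun_commute_on UNIV Delta"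
  by unfold_locales (auto simp: Delta_commute fun_eq_iff)

definition Npos :: "'d::finite \<Rightarrow> 'd lattice_fun \<Rightarrow> 'd lattice_fun" where
  "Npos i u = (\<lambda>n. of_int (n $ i) * u n)"

definition shift_diff :: "'d::finite \<Rightarrow> nat \<Rightarrow> 'd lattice_fun \<Rightarrow> 'd lattice_fun" where
  "shift_diff i p u = (\<lambda>n. shift i (int p) u n - shift i (- int p) u n)"

text \<open>Below \<open>p\<close> plays the role of the product \<open>j\<kappa>\<close>, on which alone \<open>A\<^sub>i(j,\<kappa>)\<close> depends.\<close>

definition A_dir :: "'d::finite \<Rightarrow> nat \<Rightarrow> ('d lattice_fun \<times> 'd lattice_fun) set" where
  "A_dir i p = op_closure
     {(u, \<lambda>n. 1 / (4 * \<i>) * (shift_diff i p (Npos i u) n + Npos i (shift_diff i p u) n)) | u.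
        u \<in> comp_supp}"

text \<open>The closure is needed to make the sum of the \<open>A\<^sub>i\<close> self-adjoint.\<close>

definition A_op :: "nat \<Rightarrow> ('d::finite lattice_fun \<times> 'd lattice_fun) set" where
  "A_op p = op_closure {(u, \<lambda>n. \<Sum>i\<in>UNIV. v i n) | u v. \<forall>i. (u, v i) \<in> A_dir i p}"

text \<open>
  A (finite or infinite) linear combination of the \<open>A\<^bsub>j\<kappa>\<^esub>\<close> with real coefficients: the
  series is taken in norm on compactly supported sequences, and the operator is the closure.
\<close>

definition lin_comb_core ::
  "nat \<Rightarrow> (nat \<Rightarrow> real) \<Rightarrow> ('d::finite lattice_fun \<times> 'd lattice_fun) set" where
  "lin_comb_core \<kappa> \<rho> = {(u, v). u \<in> comp_supp \<and>
     (\<exists>w. (\<forall>j\<ge>1. (u, w j) \<in> A_op (j * \<kappa>)) \<and>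
          ell2_tendsto (\<lambda>J n. \<Sum>j=1..J. complex_of_real (\<rho> (j * \<kappa>)) * w j n) v)}"

definition lin_comb ::
  "nat \<Rightarrow> (nat \<Rightarrow> real) \<Rightarrow> ('d::finite lattice_fun \<times> 'd lattice_fun) set" where
  "lin_comb \<kappa> \<rho> = op_closure (lin_comb_core \<kappa> \<rho>)"

definition selfadjoint_lin_comb ::
  "nat \<Rightarrow> (nat \<Rightarrow> real) \<Rightarrow> ('d::finite lattice_fun \<times> 'd lattice_fun) set \<Rightarrow> bool" where
  "selfadjoint_lin_comb \<kappa> \<rho> H \<longleftrightarrow>
     Domain (lin_comb_core \<kappa> \<rho> :: ('d lattice_fun \<times> 'd lattice_fun) set) = comp_supp \<and>
     H = lin_comb \<kappa> \<rho> \<and> selfadjoint H"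

text \<open>\<open>B\<close> is the bounded operator extending \<open>[T, \<i>H] = \<i>(T H - H T)\<close> from compactly supported sequences.\<close>

definition bounded_commutator ::
  "(('a \<Rightarrow> complex) \<Rightarrow> ('a \<Rightarrow> complex)) \<Rightarrow> (('a \<Rightarrow> complex) \<times> ('a \<Rightarrow> complex)) set \<Rightarrow>
   (('a \<Rightarrow> complex) \<Rightarrow> ('a \<Rightarrow> complex)) \<Rightarrow> bool" where
  "bounded_commutator T H B \<longleftrightarrow> bounded_op B \<and>
     (\<forall>u\<in>comp_supp. \<exists>v w. (u, v) \<in> H \<and> (T u, w) \<in> H \<and> B u = (\<lambda>n. \<i> * (T v n - w n)))"

section \<open>Thresholds\<close>

text \<open>
  The sets below are sets of reals, so the dimension \<open>d = CARD('d)\<close> is passed as a type argument.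
  The interval is open: otherwise \<open>I = {E}\<close>, for which \<open>1\<^sub>I(D) = 0\<close> whenever \<open>E\<close> is not an
  eigenvalue, would make the estimate void.
\<close>

definition mu :: "'d::finite itself \<Rightarrow> nat \<Rightarrow> real set" where
  "mu d \<kappa> = {E. complex_of_real E \<in> spectrum_op (MV_D :: 'd lattice_fun \<Rightarrow> 'd lattice_fun) \<and>
     (\<exists>\<rho> (H :: ('d lattice_fun \<times> 'd lattice_fun) set) B P I \<gamma>.
        selfadjoint_lin_comb \<kappa> \<rho> H \<and>
        bounded_commutator MV_D H B \<and>
        spectral_measure MV_D P \<and>
        open I \<and> is_interval I \<and> E \<in> I \<and> 0 < \<gamma> \<and>
        op_le (\<lambda>u n. complex_of_real \<gamma> * P I u n) (\<lambda>u. P I (B (P I u))))}"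

definition Theta :: "'d::finite itself \<Rightarrow> nat \<Rightarrow> real set" where
  "Theta d \<kappa> =
     {E. complex_of_real E \<in> spectrum_op (MV_D :: 'd lattice_fun \<Rightarrow> 'd lattice_fun)} - mu d \<kappa>"

fun cheb_U :: "nat \<Rightarrow> real \<Rightarrow> real" where
  "cheb_U 0 x = 1"
| "cheb_U (Suc 0) x = 2 * x"
| "cheb_U (Suc (Suc n)) x = 2 * x * cheb_U (Suc n) x - cheb_U n x"

lemma cheb_U_cos: "sin t * cheb_U n (cos t) = sin (real (Suc n) * t)"
proof (induction n rule: induct_nat_012)
  case (ge2 n)
  have "sin (real (n + 3) * t) + sin (real (n + 1) * t) = 2 * cos t * sin (real (n + 2) * t)"
  proof -
    have "real (n + 3) * t = real (n + 2) * t + t" "real (n + 1) * t = real (n + 2) * t - t"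
      by (auto simp: algebra_simps)
    then show ?thesis by (simp only: sin_add sin_diff) simp
  qed
  moreover have "sin t * cheb_U (Suc (Suc n)) (cos t) =
      2 * cos t * (sin t * cheb_U (Suc n) (cos t)) - sin t * cheb_U n (cos t)"
    by (simp add: algebra_simps)
  ultimately show ?case unfolding ge2 by (simp add: eval_nat_numeral)
qed (auto simp: sin_double)

definition g_fun :: "nat \<Rightarrow> real ^ 'd::finite \<Rightarrow> real" where
  "g_fun p x = (\<Sum>i\<in>UNIV. (\<Prod>l\<in>UNIV - {i}. x $ l) * (1 - (x $ i)\<^sup>2) * cheb_U (p - 1) (x $ i))"

definition S_energy :: "real \<Rightarrow> (real ^ 'd::finite) set" where
  "S_energy E = {x. (\<forall>l. x $ l \<in> {-1..1}) \<and> (\<Prod>l\<in>UNIV. x $ l) = E}"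

definition Theta_m :: "'d::finite itself \<Rightarrow> nat \<Rightarrow> nat \<Rightarrow> real set" where
  "Theta_m d m \<kappa> =
     (if m = 0 then
        {E \<in> {-1..1}. \<exists>x :: real ^ 'd. x \<in> S_energy E \<and> (\<forall>j\<ge>1. g_fun (j * \<kappa>) x = 0)}
      else
        {E \<in> {-1..1}. \<exists>(x :: nat \<Rightarrow> real ^ 'd) \<omega> :: nat \<Rightarrow> real.
           (\<forall>q\<le>m. x q \<in> S_energy E) \<and> (\<forall>q<m. \<omega> q \<le> 0) \<and>
           (\<forall>j\<ge>1. g_fun (j * \<kappa>) (x m) = (\<Sum>q<m. \<omega> q * g_fun (j * \<kappa>) (x q)))})"

end

theory Submission
  imports Defs
begin

text \<open>
  The first inclusion only restates that the multiples of \<open>\<alpha>\<kappa>\<close> are among the multiples of \<open>\<kappa>\<close>: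
  relations holding for all \<open>g\<^bsub>j\<kappa>\<^esub>\<close> hold in particular for all \<open>g\<^bsub>j\<alpha>\<kappa>\<^esub>\<close>.

  For the second inclusion put \<open>K = \<alpha>\<kappa>\<close>. The crux is that an energy \<open>E\<close> in \<open>\<mu>\<^sub>K(D)\<close> comes with
  coefficients \<open>\<rho>\<close> such that \<open>G = \<Sum>\<^sub>j \<rho>\<^bsub>jK\<^esub> g\<^bsub>jK\<^esub>\<close> converges and is positive on the
  constant-energy surface \<open>S\<^sub>E\<close> (lemma \<open>mu_imp_symbol_positive\<close>). Summing the relation that defines
  \<open>\<Theta>\<^sub>m\<close> against \<open>\<rho>\<close> then expresses the positive number \<open>G(x\<^sub>m)\<close> as a combination of the positive
  numbers \<open>G(x\<^sub>q)\<close> with coefficients \<open>\<omega>\<^sub>q \<le> 0\<close>, or as \<open>0\<close> if \<open>m = 0\<close>, which is absurd.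

  Positivity of \<open>G\<close> is a test with approximate eigenvectors. For \<open>x = cos \<theta>\<close> in \<open>S\<^sub>E\<close>, let \<open>u\<^sub>N\<close> be the
  plane wave of momentum \<open>\<theta>\<close> cut off to a large box and normalised. Every shift acts on \<open>u\<^sub>N\<close>
  asymptotically as multiplication by a phase (\<open>weyl_shift_defect\<close>), hence every polynomial in the
  shifts acts asymptotically as a scalar. This has three consequences.
  \<^item> \<open>(D - E) u\<^sub>N\<close> tends to \<open>0\<close>, so that \<open>E\<close> belongs to the spectrum (\<open>energy_in_spectrum\<close>), and
    the spectral projection on a neighbourhood \<open>I\<close> of \<open>E\<close> asymptotically fixes \<open>u\<^sub>N\<close>
    (\<open>P_localises\<close>).
  \<^item> \<open>[D, \<i>A\<^sub>p]\<close> is a sum over the coordinate directions of polynomials in the shifts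
    (\<open>commutator_formula\<close>), and its expectation in \<open>u\<^sub>N\<close> tends to \<open>g\<^sub>p(x)\<close>.
  \<^item> The expectation of the full commutator \<open>B\<close> tends to \<open>G(x)\<close> (\<open>commutator_symbol\<close>). The
    exchange of the limit \<open>N \<rightarrow> \<infinity>\<close> with the series over \<open>j\<close> is Tannery's theorem; it needs
    \<open>\<Sum>\<^sub>j \<bar>\<rho>\<^bsub>jK\<^esub>\<bar> < \<infinity>\<close>. That is a consequence of the unit vector at the origin being in the domain
    of the linear combination, since its square-summable image has the entries
    \<open>\<rho>\<^bsub>jK\<^esub> jK/(4\<i>)\<close> on a coordinate half-axis (\<open>coefficients_summable\<close>).

  Taking expectations in \<open>u\<^sub>N\<close> of both sides of \<open>1\<^sub>I(D) B 1\<^sub>I(D) \<ge> \<gamma> 1\<^sub>I(D)\<close> and passing to the limit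
  gives \<open>G(x) \<ge> \<gamma>\<close>.
\<close>

section \<open>Square-summable families\<close>

text \<open>
  Uniform bounds on finite sections give both membership and a norm bound; this reduces the norm
  inequalities on \<^term>\<open>ell2\<close> to the corresponding ones for finite sums.
\<close>

lemma L2_set_bounded_imp_ell2:
  assumes "\<And>F. finite F \<Longrightarrow> L2_set (\<lambda>n. cmod (u n)) F \<le> C"
  shows "u \<in> ell2" "ell2_norm u \<le> C"
proof -
  have C: "0 \<le> C" using assms[of "{}"] by simp
  have *: "(\<Sum>n\<in>F. (cmod (u n))\<^sup>2) \<le> C\<^sup>2" if "finite F" for F
    using assms[OF that] by (simp add: L2_set_def sqrt_le_D)
  show u: "u \<in> ell2"
    unfolding ell2_def mem_Collect_eq
    by (rule nonneg_bdd_above_summable_on) (use * in \<open>auto intro!: bdd_aboveI[of _ "C\<^sup>2"]\<close>)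
  have "(\<Sum>\<^sub>\<infinity>n. (cmod (u n))\<^sup>2) \<le> C\<^sup>2"
    by (rule infsum_le_finite_sums) (use u * in \<open>auto simp: ell2_def\<close>)
  then show "ell2_norm u \<le> C"
    unfolding ell2_norm_def using C real_le_lsqrt by blast
qed

lemma L2_set_le_ell2_norm:
  assumes "u \<in> ell2" "finite F"
  shows "L2_set (\<lambda>n. cmod (u n)) F \<le> ell2_norm u"
  unfolding L2_set_def ell2_norm_def
  by (rule real_sqrt_le_mono, rule finite_sum_le_infsum) (use assms in \<open>auto simp: ell2_def\<close>)

lemma ell2_norm_nonneg [simp]: "0 \<le> ell2_norm u"
  unfolding ell2_norm_def by (simp add: infsum_nonneg)

lemma ell2_norm_power2: "(ell2_norm u)\<^sup>2 = (\<Sum>\<^sub>\<infinity>n. (cmod (u n))\<^sup>2)"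
  unfolding ell2_norm_def by (simp add: infsum_nonneg)

lemma cmod_le_ell2_norm:
  assumes "u \<in> ell2" shows "cmod (u n) \<le> ell2_norm u"
  using L2_set_le_ell2_norm[OF assms, of "{n}"] by (simp add: L2_set_def)

lemma L2_set_lincomb_le:
  assumes "u \<in> ell2" "v \<in> ell2" "finite F"
  shows "L2_set (\<lambda>n. cmod (a * u n + b * v n)) F \<le> cmod a * ell2_norm u + cmod b * ell2_norm v"
proof -
  have "L2_set (\<lambda>n. cmod (a * u n + b * v n)) F
      \<le> L2_set (\<lambda>n. cmod a * cmod (u n) + cmod b * cmod (v n)) F"
    by (rule L2_set_mono) (metis norm_mult norm_triangle_ineq, simp)
  also have "\<dots> \<le> L2_set (\<lambda>n. cmod a * cmod (u n)) F + L2_set (\<lambda>n. cmod b * cmod (v n)) F"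
    by (rule L2_set_triangle_ineq)
  also have "\<dots> = cmod a * L2_set (\<lambda>n. cmod (u n)) F + cmod b * L2_set (\<lambda>n. cmod (v n)) F"
    by (simp add: L2_set_right_distrib)
  also have "\<dots> \<le> cmod a * ell2_norm u + cmod b * ell2_norm v"
    by (intro add_mono mult_left_mono L2_set_le_ell2_norm assms) auto
  finally show ?thesis .
qed

lemma ell2_lincomb:
  assumes "u \<in> ell2" "v \<in> ell2"
  shows "(\<lambda>n. a * u n + b * v n) \<in> ell2"
    and "ell2_norm (\<lambda>n. a * u n + b * v n) \<le> cmod a * ell2_norm u + cmod b * ell2_norm v"
  using L2_set_bounded_imp_ell2[OF L2_set_lincomb_le[OF assms]] by auto

lemma ell2_zero: "(\<lambda>n. 0) \<in> ell2" "ell2_norm (\<lambda>n. 0) = 0"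
  by (auto simp: ell2_def ell2_norm_def)

lemma ell2_add: "u \<in> ell2 \<Longrightarrow> v \<in> ell2 \<Longrightarrow> (\<lambda>n. u n + v n) \<in> ell2"
  using ell2_lincomb(1)[of u v 1 1] by simp

lemma ell2_diff: "u \<in> ell2 \<Longrightarrow> v \<in> ell2 \<Longrightarrow> (\<lambda>n. u n - v n) \<in> ell2"
  using ell2_lincomb(1)[of u v 1 "-1"] by simp

lemma ell2_scale: "u \<in> ell2 \<Longrightarrow> (\<lambda>n. a * u n) \<in> ell2"
  using ell2_lincomb(1)[of u u a 0] by simp

lemma ell2_norm_triangle:
  "u \<in> ell2 \<Longrightarrow> v \<in> ell2 \<Longrightarrow> ell2_norm (\<lambda>n. u n + v n) \<le> ell2_norm u + ell2_norm v"
  using ell2_lincomb(2)[of u v 1 1] by simp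

lemma ell2_inner_summable:
  assumes "u \<in> ell2" "v \<in> ell2"
  shows "(\<lambda>n. norm (cnj (u n) * v n)) summable_on UNIV"
proof -
  have "(\<lambda>n. (cmod (u n))\<^sup>2 + (cmod (v n))\<^sup>2) summable_on UNIV"
    using assms by (intro summable_on_add) (auto simp: ell2_def)
  then show ?thesis
  proof (rule summable_on_comparison_test)
    fix n
    have "cmod (u n) * cmod (v n) \<le> (cmod (u n))\<^sup>2 + (cmod (v n))\<^sup>2"
      using sum_squares_bound[of "cmod (u n)" "cmod (v n)"]
        mult_nonneg_nonneg[OF norm_ge_zero norm_ge_zero, of "u n" "v n"] by linarith
    then show "norm (cnj (u n) * v n) \<le> (cmod (u n))\<^sup>2 + (cmod (v n))\<^sup>2"
      by (simp add: norm_mult)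
  qed auto
qed

lemma ell2_Cauchy_Schwarz:
  assumes "u \<in> ell2" "v \<in> ell2"
  shows "cmod (ell2_inner u v) \<le> ell2_norm u * ell2_norm v"
proof -
  have "cmod (ell2_inner u v) \<le> (\<Sum>\<^sub>\<infinity>n. cmod (cnj (u n) * v n))"
    unfolding ell2_inner_def by (rule norm_infsum_bound[OF ell2_inner_summable[OF assms]])
  also have "\<dots> \<le> ell2_norm u * ell2_norm v"
  proof (rule infsum_le_finite_sums[OF ell2_inner_summable[OF assms]])
    fix F :: "'a set" assume F: "finite F"
    have "(\<Sum>n\<in>F. cmod (cnj (u n) * v n)) \<le> L2_set (\<lambda>n. cmod (u n)) F * L2_set (\<lambda>n. cmod (v n)) F"
      using L2_set_mult_ineq[of "\<lambda>n. cmod (u n)" "\<lambda>n. cmod (v n)" F] by (simp add: norm_mult)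
    also have "\<dots> \<le> ell2_norm u * ell2_norm v"
      by (intro mult_mono L2_set_le_ell2_norm assms F) auto
    finally show "(\<Sum>n\<in>F. cmod (cnj (u n) * v n)) \<le> ell2_norm u * ell2_norm v" .
  qed
  finally show ?thesis .
qed

lemma ell2_inner_lincomb_right:
  assumes "u \<in> ell2" "v \<in> ell2" "w \<in> ell2"
  shows "ell2_inner w (\<lambda>n. a * u n + b * v n) = a * ell2_inner w u + b * ell2_inner w v"
proof -
  have s: "(\<lambda>n. cnj (w n) * u n) summable_on UNIV" "(\<lambda>n. cnj (w n) * v n) summable_on UNIV"
    by (rule abs_summable_summable, rule ell2_inner_summable; fact assms)+
  have "ell2_inner w (\<lambda>n. a * u n + b * v n)
      = (\<Sum>\<^sub>\<infinity>n. a * (cnj (w n) * u n) + b * (cnj (w n) * v n))"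
    unfolding ell2_inner_def by (simp add: algebra_simps)
  also have "\<dots> = (\<Sum>\<^sub>\<infinity>n. a * (cnj (w n) * u n)) + (\<Sum>\<^sub>\<infinity>n. b * (cnj (w n) * v n))"
    by (intro infsum_add summable_on_cmult_right s)
  also have "\<dots> = a * ell2_inner w u + b * ell2_inner w v"
    unfolding ell2_inner_def by (simp only: infsum_cmult_right')
  finally show ?thesis .
qed

lemma ell2_inner_commute: "ell2_inner u v = cnj (ell2_inner v u)"
proof -
  have "cnj (ell2_inner v u) = (\<Sum>\<^sub>\<infinity>n. cnj (cnj (v n) * u n))"
    unfolding ell2_inner_def by (rule infsum_cnj[symmetric])
  then show ?thesis by (simp add: ell2_inner_def mult.commute)
qed

lemma ell2_inner_lincomb_left:
  assumes "u \<in> ell2" "v \<in> ell2" "w \<in> ell2"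
  shows "ell2_inner (\<lambda>n. a * u n + b * v n) w = cnj a * ell2_inner u w + cnj b * ell2_inner v w"
  using ell2_inner_lincomb_right[OF assms, of a b]
  by (metis complex_cnj_add complex_cnj_mult ell2_inner_commute)

lemma ell2_inner_add_right:
  "u \<in> ell2 \<Longrightarrow> v \<in> ell2 \<Longrightarrow> w \<in> ell2 \<Longrightarrow>
    ell2_inner w (\<lambda>n. u n + v n) = ell2_inner w u + ell2_inner w v"
  using ell2_inner_lincomb_right[of u v w 1 1] by simp

lemma ell2_inner_diff_right:
  "u \<in> ell2 \<Longrightarrow> v \<in> ell2 \<Longrightarrow> w \<in> ell2 \<Longrightarrow>
    ell2_inner w (\<lambda>n. u n - v n) = ell2_inner w u - ell2_inner w v"
  using ell2_inner_lincomb_right[of u v w 1 "-1"] by simp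

lemma ell2_inner_scale_right:
  "ell2_inner w (\<lambda>n. a * u n) = a * ell2_inner w u"
proof -
  have "(\<lambda>n. cnj (w n) * (a * u n)) = (\<lambda>n. a * (cnj (w n) * u n))"
    by (simp add: fun_eq_iff)
  then show ?thesis by (simp add: ell2_inner_def infsum_cmult_right')
qed

lemma ell2_inner_self:
  assumes "u \<in> ell2" shows "ell2_inner u u = complex_of_real ((ell2_norm u)\<^sup>2)"
proof -
  have "((\<lambda>n. (cmod (u n))\<^sup>2) has_sum (ell2_norm u)\<^sup>2) UNIV"
    using assms by (simp add: ell2_norm_power2 ell2_def has_sum_infsum)
  then have "((\<lambda>n. complex_of_real ((cmod (u n))\<^sup>2)) has_sum complex_of_real ((ell2_norm u)\<^sup>2)) UNIV"
    by (simp only: has_sum_of_real_iff)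
  then have "(\<Sum>\<^sub>\<infinity>n. complex_of_real ((cmod (u n))\<^sup>2)) = complex_of_real ((ell2_norm u)\<^sup>2)"
    by (rule infsumI)
  moreover have "ell2_inner u u = (\<Sum>\<^sub>\<infinity>n. complex_of_real ((cmod (u n))\<^sup>2))"
    unfolding ell2_inner_def by (rule infsum_cong) (metis complex_norm_square mult.commute)
  ultimately show ?thesis by simp
qed

lemma ell2_tendsto_pointwise:
  assumes "ell2_tendsto U u" shows "(\<lambda>k. U k n) \<longlonglongrightarrow> u n"
proof -
  have "(\<lambda>k. ell2_norm (\<lambda>n. U k n - u n)) \<longlonglongrightarrow> 0" using assms by (simp add: ell2_tendsto_def)
  then have "(\<lambda>k. U k n - u n) \<longlonglongrightarrow> 0"
  proof (rule Lim_null_comparison[rotated], intro always_eventually allI)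
    fix k show "norm (U k n - u n) \<le> ell2_norm (\<lambda>n. U k n - u n)"
      by (rule cmod_le_ell2_norm) (use assms in \<open>auto simp: ell2_tendsto_def intro: ell2_diff\<close>)
  qed
  then show ?thesis by (rule LIM_zero_cancel)
qed

lemma ell2_tendsto_const: "u \<in> ell2 \<Longrightarrow> ell2_tendsto (\<lambda>k. u) u"
  by (simp add: ell2_tendsto_def ell2_zero)

lemma ell2_tendsto_inner:
  assumes "ell2_tendsto U u" "w \<in> ell2"
  shows "(\<lambda>k. ell2_inner w (U k)) \<longlonglongrightarrow> ell2_inner w u"
proof -
  have mem: "U k \<in> ell2" "u \<in> ell2" for k using assms by (auto simp: ell2_tendsto_def)
  have "(\<lambda>k. ell2_norm w * ell2_norm (\<lambda>n. U k n - u n)) \<longlonglongrightarrow> ell2_norm w * 0"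
    by (intro tendsto_mult tendsto_const) (use assms in \<open>simp add: ell2_tendsto_def\<close>)
  then have lim: "(\<lambda>k. ell2_norm w * ell2_norm (\<lambda>n. U k n - u n)) \<longlonglongrightarrow> 0" by simp
  have "(\<lambda>k. ell2_inner w (U k) - ell2_inner w u) \<longlonglongrightarrow> 0"
  proof (rule Lim_null_comparison[OF _ lim], intro always_eventually allI)
    fix k
    show "norm (ell2_inner w (U k) - ell2_inner w u) \<le> ell2_norm w * ell2_norm (\<lambda>n. U k n - u n)"
      using ell2_Cauchy_Schwarz[OF assms(2) ell2_diff[OF mem]]
        ell2_inner_diff_right[OF mem assms(2)] by metis
  qed
  then show ?thesis by (rule LIM_zero_cancel)
qed

lemma comp_supp_ell2: "u \<in> comp_supp \<Longrightarrow> u \<in> ell2"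
  unfolding comp_supp_def ell2_def
  by (auto intro!: finite_nonzero_values_imp_summable_on)

lemma comp_supp_norm:
  assumes "finite F" "\<And>n. n \<notin> F \<Longrightarrow> u n = 0"
  shows "(ell2_norm u)\<^sup>2 = (\<Sum>n\<in>F. (cmod (u n))\<^sup>2)"
proof -
  have "(\<Sum>\<^sub>\<infinity>n. (cmod (u n))\<^sup>2) = (\<Sum>\<^sub>\<infinity>n\<in>F. (cmod (u n))\<^sup>2)"
    by (rule infsum_cong_neutral) (use assms in auto)
  then show ?thesis using assms by (simp add: ell2_norm_power2)
qed

lemma comp_supp_inner:
  assumes "finite F" "\<And>n. n \<notin> F \<Longrightarrow> u n = 0"
  shows "ell2_inner u v = (\<Sum>n\<in>F. cnj (u n) * v n)"
proof -
  have "ell2_inner u v = (\<Sum>\<^sub>\<infinity>n\<in>F. cnj (u n) * v n)"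
    unfolding ell2_inner_def by (rule infsum_cong_neutral) (use assms in auto)
  then show ?thesis using assms by simp
qed

section \<open>Shifts, the Laplacian and its commutators\<close>

text \<open>
  Only linear maps are considered. All the operators built from shifts below have norm at most \<open>1\<close>,
  so that this class saves carrying operator norms along.
\<close>

definition contraction :: "(('a \<Rightarrow> complex) \<Rightarrow> ('a \<Rightarrow> complex)) \<Rightarrow> bool" where
  "contraction F \<longleftrightarrow>
     (\<forall>u v a b. F (\<lambda>n. a * u n + b * v n) = (\<lambda>n. a * F u n + b * F v n)) \<and>
     (\<forall>u\<in>ell2. F u \<in> ell2 \<and> ell2_norm (F u) \<le> ell2_norm u)"

lemma contraction_linear:
  "contraction F \<Longrightarrow> F (\<lambda>n. a * u n + b * v n) = (\<lambda>n. a * F u n + b * F v n)"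
  by (simp add: contraction_def)

lemma contraction_ell2: "contraction F \<Longrightarrow> u \<in> ell2 \<Longrightarrow> F u \<in> ell2"
  by (simp add: contraction_def)

lemma contraction_norm: "contraction F \<Longrightarrow> u \<in> ell2 \<Longrightarrow> ell2_norm (F u) \<le> ell2_norm u"
  by (simp add: contraction_def)

lemma contraction_comp:
  assumes F: "contraction F" and G: "contraction G"
  shows "contraction (\<lambda>u. F (G u))"
  unfolding contraction_def
proof (intro conjI allI ballI)
  fix u v :: "'a \<Rightarrow> complex" and a b
  show "F (G (\<lambda>n. a * u n + b * v n)) = (\<lambda>n. a * F (G u) n + b * F (G v) n)"
    by (simp only: contraction_linear[OF F] contraction_linear[OF G])
next
  fix u :: "'a \<Rightarrow> complex" assume u: "u \<in> ell2"
  note Gu = contraction_ell2[OF G u]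
  show "F (G u) \<in> ell2" by (rule contraction_ell2[OF F Gu])
  show "ell2_norm (F (G u)) \<le> ell2_norm u"
    by (rule order_trans[OF contraction_norm[OF F Gu] contraction_norm[OF G u]])
qed

lemma contraction_mix:
  assumes F: "contraction F" and G: "contraction G" and ab: "cmod a + cmod b \<le> 1"
  shows "contraction (\<lambda>u n. a * F u n + b * G u n)"
  unfolding contraction_def
proof (intro conjI allI ballI)
  fix u v :: "'a \<Rightarrow> complex" and c d
  show "(\<lambda>n. a * F (\<lambda>n. c * u n + d * v n) n + b * G (\<lambda>n. c * u n + d * v n) n) =
      (\<lambda>n. c * (a * F u n + b * G u n) + d * (a * F v n + b * G v n))"
    by (simp add: contraction_linear[OF F] contraction_linear[OF G] algebra_simps)
next
  fix u :: "'a \<Rightarrow> complex" assume u: "u \<in> ell2"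
  note FG = contraction_ell2[OF F u] contraction_ell2[OF G u]
  show "(\<lambda>n. a * F u n + b * G u n) \<in> ell2" by (rule ell2_lincomb(1)[OF FG])
  have "ell2_norm (\<lambda>n. a * F u n + b * G u n) \<le> cmod a * ell2_norm (F u) + cmod b * ell2_norm (G u)"
    by (rule ell2_lincomb(2)[OF FG])
  also have "\<dots> \<le> cmod a * ell2_norm u + cmod b * ell2_norm u"
    by (intro add_mono mult_left_mono contraction_norm F G u) auto
  also have "\<dots> = (cmod a + cmod b) * ell2_norm u" by (simp add: algebra_simps)
  also have "\<dots> \<le> 1 * ell2_norm u" by (intro mult_right_mono ab) simp
  finally show "ell2_norm (\<lambda>n. a * F u n + b * G u n) \<le> ell2_norm u" by simp
qed

lemma contraction_zero: "contraction F \<Longrightarrow> F (\<lambda>n. 0) = (\<lambda>n. 0)"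
  using contraction_linear[of F 0 "\<lambda>n. 0" 0 "\<lambda>n. 0"] by simp

lemma contraction_sum:
  assumes F: "contraction F" and A: "finite A"
  shows "F (\<lambda>n. \<Sum>i\<in>A. c i * w i n) = (\<lambda>n. \<Sum>i\<in>A. c i * F (w i) n)"
  using A
proof induction
  case empty
  then show ?case by (simp add: contraction_zero[OF F])
next
  case (insert i A)
  have "F (\<lambda>n. \<Sum>i\<in>insert i A. c i * w i n) = F (\<lambda>n. c i * w i n + 1 * (\<Sum>i\<in>A. c i * w i n))"
    using insert by simp
  also have "\<dots> = (\<lambda>n. c i * F (w i) n + 1 * F (\<lambda>n. \<Sum>i\<in>A. c i * w i n) n)"
    by (rule contraction_linear[OF F])
  finally show ?case using insert by simp
qed

lemma contraction_shift: "contraction (shift i k)"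
proof -
  have bij: "bij_betw (\<lambda>n. n - axis i k) UNIV (UNIV :: (int ^ 'a) set)"
    by (rule bij_betw_byWitness[where f' = "\<lambda>n. n + axis i k"]) auto
  have "(\<Sum>\<^sub>\<infinity>n. (cmod (u (n - axis i k)))\<^sup>2) = (\<Sum>\<^sub>\<infinity>n. (cmod (u n))\<^sup>2)" for u :: "int ^ 'a \<Rightarrow> complex"
    using infsum_reindex_bij_betw[OF bij, of "\<lambda>n. (cmod (u n))\<^sup>2"] by simp
  moreover have "(\<lambda>n. (cmod (u (n - axis i k)))\<^sup>2) summable_on UNIV \<longleftrightarrow>
      (\<lambda>n. (cmod (u n))\<^sup>2) summable_on UNIV" for u :: "int ^ 'a \<Rightarrow> complex"
    using summable_on_reindex_bij_betw[OF bij, of "\<lambda>n. (cmod (u n))\<^sup>2"] by simp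
  ultimately show ?thesis
    unfolding contraction_def by (auto simp: shift_def ell2_def ell2_norm_def)
qed

lemma Delta_eq_mix: "Delta i u = (\<lambda>n. 1/2 * shift i 1 u n + 1/2 * shift i (-1) u n)"
  by (simp add: Delta_def fun_eq_iff add_divide_distrib)

lemma contraction_Delta: "contraction (Delta i)"
proof -
  have "Delta i = (\<lambda>u n. 1/2 * shift i 1 u n + 1/2 * shift i (-1) u n)"
    by (rule ext) (rule Delta_eq_mix)
  then show ?thesis by (simp only:) (intro contraction_mix contraction_shift; simp)
qed

definition Delta_prod :: "'d::finite set \<Rightarrow> 'd lattice_fun \<Rightarrow> 'd lattice_fun" where
  "Delta_prod A u = Finite_Set.fold Delta u A"

lemma Delta_prod_empty: "Delta_prod {} u = u"
  by (simp add: Delta_prod_def)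

lemma Delta_prod_insert: "i \<notin> A \<Longrightarrow> Delta_prod (insert i A) u = Delta i (Delta_prod A u)"
  unfolding Delta_prod_def
  by (rule comp_fun_commute_on.fold_insert[OF comp_fun_commute_Delta]) auto

lemma MV_D_eq_Delta_prod: "MV_D = Delta_prod UNIV"
  by (simp add: fun_eq_iff MV_D_def Delta_prod_def)

lemma MV_D_split: "MV_D u = Delta i (Delta_prod (UNIV - {i}) u)"
proof -
  have "MV_D u = Delta_prod (insert i (UNIV - {i})) u"
    by (simp add: MV_D_eq_Delta_prod insert_absorb)
  then show ?thesis by (subst (asm) Delta_prod_insert) auto
qed

lemma contraction_Delta_prod: "contraction (Delta_prod A)"
proof (induction A rule: finite_induct[OF finite])
  case 1
  then show ?case by (simp add: contraction_def Delta_prod_empty)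
next
  case (2 i A)
  then have "Delta_prod (insert i A) = (\<lambda>u. Delta i (Delta_prod A u))"
    by (auto simp: Delta_prod_insert fun_eq_iff)
  then show ?case using 2 by (simp add: contraction_comp contraction_Delta)
qed

lemma contraction_MV_D: "contraction MV_D"
  unfolding MV_D_eq_Delta_prod by (rule contraction_Delta_prod)

text \<open>
  The operators built from shifts are local, hence continuous even for pointwise convergence of
  arbitrary families. This makes it possible to work with the series for the conjugate operator one
  lattice point at a time.
\<close>

lemma Delta_prod_pointwise:
  assumes "\<And>n. (\<lambda>k. U k n) \<longlonglongrightarrow> u n"
  shows "(\<lambda>k. Delta_prod A (U k) n) \<longlonglongrightarrow> Delta_prod A u n"
proof (induction A arbitrary: n rule: finite_induct[OF finite])
  case 1
  then show ?case by (simp add: Delta_prod_empty assms)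
next
  case (2 i A)
  then show ?case
    by (auto simp: Delta_prod_insert Delta_def shift_def intro!: tendsto_intros)
qed

lemma comp_supp_shift:
  assumes "u \<in> comp_supp" shows "shift i k u \<in> comp_supp"
proof -
  have "{n. shift i k u n \<noteq> 0} = (\<lambda>n. n + axis i k) ` {n. u n \<noteq> 0}"
    by (force simp: shift_def image_iff intro: exI[of _ "_ - axis i k"])
  then show ?thesis using assms by (simp add: comp_supp_def)
qed

lemma comp_supp_lincomb:
  assumes "u \<in> comp_supp" "v \<in> comp_supp" shows "(\<lambda>n. a * u n + b * v n) \<in> comp_supp"
proof -
  have "{n. a * u n + b * v n \<noteq> 0} \<subseteq> {n. u n \<noteq> 0} \<union> {n. v n \<noteq> 0}" by auto
  moreover have "finite ({n. u n \<noteq> 0} \<union> {n. v n \<noteq> 0})"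
    using assms by (simp add: comp_supp_def)
  ultimately show ?thesis unfolding comp_supp_def mem_Collect_eq by (rule finite_subset)
qed

lemma comp_supp_MV_D: 
  assumes "u \<in> comp_supp" shows "MV_D u \<in> comp_supp"
proof -
  have "Delta_prod A u \<in> comp_supp" for A
  proof (induction A rule: finite_induct[OF finite])
    case 1
    then show ?case by (simp add: Delta_prod_empty assms)
  next
    case (2 i A)
    then show ?case
      by (simp add: Delta_prod_insert) (simp only: Delta_eq_mix comp_supp_lincomb comp_supp_shift)
  qed
  then show ?thesis by (simp add: MV_D_eq_Delta_prod)
qed

definition A_dir_fun :: "'d::finite \<Rightarrow> nat \<Rightarrow> 'd lattice_fun \<Rightarrow> 'd lattice_fun" where
  "A_dir_fun i p u = (\<lambda>n. 1 / (4 * \<i>) * (shift_diff i p (Npos i u) n + Npos i (shift_diff i p u) n))"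

definition A_fun :: "nat \<Rightarrow> 'd::finite lattice_fun \<Rightarrow> 'd lattice_fun" where
  "A_fun p u = (\<lambda>n. \<Sum>i\<in>UNIV. A_dir_fun i p u n)"

lemma A_dir_fun_pointwise:
  assumes "\<And>n. (\<lambda>k. U k n) \<longlonglongrightarrow> u n"
  shows "(\<lambda>k. A_dir_fun i p (U k) n) \<longlonglongrightarrow> A_dir_fun i p u n"
  unfolding A_dir_fun_def shift_diff_def Npos_def shift_def
  by (intro tendsto_intros assms)

text \<open>
  The closures do not alter the formula: norm convergence implies pointwise convergence, and the
  expression on compactly supported sequences is local, so it survives the limit on all of the domain.
\<close>

lemma A_dir_eq:
  assumes "(u, v) \<in> A_dir i p" shows "v = A_dir_fun i p u"
proof
  fix n
  obtain U V where UV: "\<And>k. V k = A_dir_fun i p (U k)" "ell2_tendsto U u" "ell2_tendsto V v"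
    using assms unfolding A_dir_def op_closure_def A_dir_fun_def by auto
  have "(\<lambda>k. V k n) \<longlonglongrightarrow> A_dir_fun i p u n"
    unfolding UV(1) by (intro A_dir_fun_pointwise ell2_tendsto_pointwise UV)
  then show "v n = A_dir_fun i p u n"
    using ell2_tendsto_pointwise[OF UV(3)] LIMSEQ_unique by blast
qed

lemma A_op_eq:
  assumes "(u, v) \<in> A_op p" shows "v = A_fun p u"
proof
  fix n
  obtain U V where UV: "\<And>k. (U k, V k) \<in> {(u, \<lambda>n. \<Sum>i\<in>UNIV. v i n) | u v. \<forall>i. (u, v i) \<in> A_dir i p}"
    and lim: "ell2_tendsto U u" "ell2_tendsto V v"
    using assms unfolding A_op_def op_closure_def by auto
  have V: "V k = A_fun p (U k)" for k
  proof -
    obtain w where w: "V k = (\<lambda>n. \<Sum>i\<in>UNIV. w i n)" "\<And>i. (U k, w i) \<in> A_dir i p"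
      using UV[of k] by blast
    have "w i = A_dir_fun i p (U k)" for i by (rule A_dir_eq[OF w(2)])
    then show ?thesis by (simp add: w(1) A_fun_def)
  qed
  have "(\<lambda>k. V k n) \<longlonglongrightarrow> A_fun p u n"
    unfolding V A_fun_def by (intro tendsto_intros A_dir_fun_pointwise ell2_tendsto_pointwise lim)
  then show "v n = A_fun p u n"
    using ell2_tendsto_pointwise[OF lim(2)] LIMSEQ_unique by blast
qed

text \<open>
  On a plane wave this multiplies by \<open>-\<i> sin (p \<theta>\<^sub>i)\<close>.
\<close>

definition half_diff :: "'d::finite \<Rightarrow> nat \<Rightarrow> 'd lattice_fun \<Rightarrow> 'd lattice_fun" where
  "half_diff i p u = (\<lambda>n. 1/2 * shift i (int p) u n + (-1/2) * shift i (- int p) u n)"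

text \<open>
  Up to sign, the summand of \<open>[D, \<i>A\<^sub>p]\<close> that stems from direction \<open>i\<close>; its symbol is
  \<open>- (\<Prod>\<^bsub>l\<noteq>i\<^esub> cos \<theta>\<^sub>l) sin \<theta>\<^sub>i sin (p \<theta>\<^sub>i)\<close>.
\<close>

definition comm_dir :: "'d::finite \<Rightarrow> nat \<Rightarrow> 'd lattice_fun \<Rightarrow> 'd lattice_fun" where
  "comm_dir i p u = half_diff i p (half_diff i 1 (Delta_prod (UNIV - {i}) u))"

lemma contraction_half_diff: "contraction (half_diff i p)"
proof -
  have "half_diff i p = (\<lambda>u n. 1/2 * shift i (int p) u n + (-1/2) * shift i (- int p) u n)"
    by (simp add: fun_eq_iff half_diff_def)
  then show ?thesis by (simp only:) (intro contraction_mix contraction_shift; simp)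
qed

lemma contraction_comm_dir: "contraction (comm_dir i p)"
proof -
  have "comm_dir i p = (\<lambda>u. half_diff i p (half_diff i 1 (Delta_prod (UNIV - {i}) u)))"
    by (simp add: fun_eq_iff comm_dir_def)
  then show ?thesis
    using contraction_comp[OF contraction_half_diff
        contraction_comp[OF contraction_half_diff contraction_Delta_prod]] by metis
qed

lemma axis_add_int: "axis i a + axis i b = axis i (a + b :: int)"
  by (simp add: vec_eq_iff axis_def)

text \<open>
  The position operator contributes only through \<open>[N\<^sub>i, S\<^sub>i\<^sup>k] = k S\<^sub>i\<^sup>k\<close>, so the unbounded parts
  cancel and differences of shifts are left.
\<close>

lemma commutator_dir:
  "\<i> * (Delta i (A_dir_fun i p w) n - A_dir_fun i p (Delta i w) n) = - half_diff i p (half_diff i 1 w) n"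
proof -
  have e: "n - axis i a - axis i b = n - axis i (a + b)" for a b :: int
    by (simp add: axis_add_int[symmetric])
  show ?thesis
    unfolding Delta_def A_dir_fun_def half_diff_def shift_diff_def Npos_def shift_def
    by (simp add: e axis_def[of _ _] field_simps)
qed

lemma A_dir_fun_Delta_commute:
  assumes "l \<noteq> i"
  shows "Delta l (A_dir_fun i p w) = A_dir_fun i p (Delta l w)"
proof
  fix n
  have e: "n - axis l a - axis i b = n - axis i b - axis l a" for a b :: int
    by simp
  have z: "axis l a $ i = 0" for a :: int using assms by (simp add: axis_def)
  show "Delta l (A_dir_fun i p w) n = A_dir_fun i p (Delta l w) n"
    unfolding Delta_def A_dir_fun_def shift_diff_def Npos_def shift_def
    by (simp add: e z field_simps)
qed

lemma A_dir_fun_Delta_prod_commute: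
  "i \<notin> A \<Longrightarrow> Delta_prod A (A_dir_fun i p w) = A_dir_fun i p (Delta_prod A w)"
proof (induction A rule: finite_induct[OF finite])
  case 1
  then show ?case by (simp add: Delta_prod_empty)
next
  case (2 l A)
  then show ?case by (auto simp: Delta_prod_insert A_dir_fun_Delta_commute)
qed

text \<open>
  In \<open>[D, \<i>A\<^sub>i]\<close> the factors \<open>\<Delta>\<^sub>l\<close> with \<open>l \<noteq> i\<close> commute with \<open>A\<^sub>i\<close> and can be pulled out.
\<close>

lemma commutator_formula:
  "\<i> * (MV_D (A_fun p u) n - A_fun p (MV_D u) n) = - (\<Sum>i\<in>UNIV. comm_dir i p u n)"
proof -
  have "MV_D (A_fun p u) = (\<lambda>n. \<Sum>i\<in>UNIV. MV_D (A_dir_fun i p u) n)"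
    using contraction_sum[OF contraction_MV_D finite, of "\<lambda>i. 1" "\<lambda>i. A_dir_fun i p u" UNIV]
    by (simp add: A_fun_def)
  then have "\<i> * (MV_D (A_fun p u) n - A_fun p (MV_D u) n)
      = (\<Sum>i\<in>UNIV. \<i> * (MV_D (A_dir_fun i p u) n - A_dir_fun i p (MV_D u) n))"
    by (simp add: A_fun_def sum_subtractf sum_distrib_left algebra_simps)
  also have "\<dots> = (\<Sum>i\<in>UNIV. - comm_dir i p u n)"
  proof (rule sum.cong[OF refl])
    fix i
    show "\<i> * (MV_D (A_dir_fun i p u) n - A_dir_fun i p (MV_D u) n) = - comm_dir i p u n"
      by (simp add: MV_D_split[of _ i] A_dir_fun_Delta_prod_commute commutator_dir comm_dir_def)
  qed
  finally show ?thesis by (simp add: sum_negf)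
qed

section \<open>Approximate eigenvectors of plane-wave type\<close>

definition plane_wave :: "('d::finite \<Rightarrow> real) \<Rightarrow> 'd lattice_fun" where
  "plane_wave \<theta> n = cis (\<Sum>i\<in>UNIV. \<theta> i * of_int (n $ i))"

definition lattice_box :: "nat \<Rightarrow> (int ^ 'd::finite) set" where
  "lattice_box N = {n. \<forall>i. n $ i \<in> {0..int N}}"

text \<open>
  The box has side \<open>N + 1\<close>, so that these vectors are normalised for every \<open>N\<close>, zero included.
\<close>

definition weyl :: "('d::finite \<Rightarrow> real) \<Rightarrow> nat \<Rightarrow> 'd lattice_fun" where
  "weyl \<theta> N n = complex_of_real (indicator (lattice_box N) n / sqrt (real (card (lattice_box N :: (int ^ 'd) set)))) *
     plane_wave \<theta> n"

lemma
  fixes A :: "'d::finite \<Rightarrow> int set"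
  assumes "\<And>i. finite (A i)"
  shows finite_vec_box: "finite {n :: int ^ 'd. \<forall>i. n $ i \<in> A i}"
    and card_vec_box: "card {n :: int ^ 'd. \<forall>i. n $ i \<in> A i} = (\<Prod>i\<in>UNIV. card (A i))"
proof -
  have bij: "bij_betw vec_nth {n :: int ^ 'd. \<forall>i. n $ i \<in> A i} (Pi\<^sub>E UNIV A)"
  proof (rule bij_betw_byWitness[where f' = vec_lambda])
  qed (auto simp: PiE_def extensional_def)
  have "finite (Pi\<^sub>E UNIV A)" using assms by (intro finite_PiE) auto
  then show "finite {n :: int ^ 'd. \<forall>i. n $ i \<in> A i}" using bij bij_betw_finite by blast
  show "card {n :: int ^ 'd. \<forall>i. n $ i \<in> A i} = (\<Prod>i\<in>UNIV. card (A i))"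
    using bij_betw_same_card[OF bij] by (simp add: card_PiE)
qed

lemma finite_lattice_box: "finite (lattice_box N)"
  unfolding lattice_box_def by (rule finite_vec_box) simp

lemma card_lattice_box: "card (lattice_box N :: (int ^ 'd::finite) set) = Suc N ^ CARD('d)"
  unfolding lattice_box_def by (subst card_vec_box) (simp_all add: nat_add_distrib)

lemma card_lattice_box_pos: "0 < card (lattice_box N :: (int ^ 'd::finite) set)"
  by (simp add: card_lattice_box)

lemma plane_wave_shift: "plane_wave \<theta> (n - axis i k) = cis (- (\<theta> i * of_int k)) * plane_wave \<theta> n"
proof -
  have "(\<Sum>j\<in>UNIV. \<theta> j * of_int ((n - axis i k) $ j))
      = (\<Sum>j\<in>UNIV. \<theta> j * of_int (n $ j) - (if j = i then \<theta> i * of_int k else 0))"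
    by (rule sum.cong) (auto simp: axis_def algebra_simps)
  also have "\<dots> = (\<Sum>j\<in>UNIV. \<theta> j * of_int (n $ j)) - \<theta> i * of_int k"
    by (simp add: sum_subtractf)
  finally have "plane_wave \<theta> (n - axis i k) = cis ((\<Sum>j\<in>UNIV. \<theta> j * of_int (n $ j)) - \<theta> i * of_int k)"
    by (simp only: plane_wave_def)
  then show ?thesis by (simp add: plane_wave_def cis_mult)
qed

lemma cmod_plane_wave: "cmod (plane_wave \<theta> n) = 1"
  by (simp add: plane_wave_def)

lemma weyl_outside: "n \<notin> lattice_box N \<Longrightarrow> weyl \<theta> N n = 0"
  by (simp add: weyl_def)

lemma weyl_comp_supp: "weyl \<theta> N \<in> comp_supp"
proof -
  have "{n. weyl \<theta> N n \<noteq> 0} \<subseteq> lattice_box N" using weyl_outside by auto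
  then show ?thesis unfolding comp_supp_def using finite_lattice_box finite_subset by blast
qed

lemma weyl_ell2: "weyl \<theta> N \<in> ell2"
  by (rule comp_supp_ell2[OF weyl_comp_supp])

lemma weyl_norm: "ell2_norm (weyl \<theta> N) = 1"
proof -
  have "(ell2_norm (weyl \<theta> N))\<^sup>2 = (\<Sum>n\<in>lattice_box N. (cmod (weyl \<theta> N n))\<^sup>2)"
    by (rule comp_supp_norm[OF finite_lattice_box weyl_outside])
  also have "\<dots> = 1"
    using card_lattice_box_pos[of N, where ?'d = 'a]
    by (simp add: weyl_def norm_mult cmod_plane_wave norm_divide power_divide)
  finally show ?thesis
    using power2_eq_iff_nonneg[of "ell2_norm (weyl \<theta> N)" 1] by simp
qed

text \<open>
  The shift of a plane wave is exact, so the defect lives on the lattice points that belong to exactly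
  one of the box and its translate. These form at most \<open>2\<bar>k\<bar>\<close> of the slices orthogonal to direction
  \<open>i\<close>, out of the \<open>N + 1\<close> slices of the box.
\<close>

lemma weyl_shift_defect:
  "ell2_norm (\<lambda>n. shift i k (weyl \<theta> N) n - cis (- (\<theta> i * of_int k)) * weyl \<theta> N n)
     \<le> sqrt (2 * \<bar>real_of_int k\<bar> / real (Suc N))" (is "ell2_norm ?u \<le> _")
proof -
  \<comment> \<open>\<open>F\<close> is the symmetric difference of the box and its translate: only coordinate \<open>i\<close> is restricted to a symmetric difference \<open>D\<close> of intervals.\<close>
  define I J :: "int set" where "I = {0..int N}" and "J = {k..int N + k}"
  define D where "D = (I - J) \<union> (J - I)"
  define F :: "(int ^ 'a) set" where "F = {n. \<forall>l. n $ l \<in> (if l = i then D else I)}"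
  define c where "c = real (card (lattice_box N :: (int ^ 'a) set))"
  have fin: "finite D" "finite I" by (auto simp: D_def I_def J_def)
  have cD: "card D \<le> nat (2 * \<bar>k\<bar>)"
  proof -
    have "card D \<le> card ((I - J) \<union> (J - I))" by (simp add: D_def)
    also have "\<dots> \<le> card (I - J) + card (J - I)" by (rule card_Un_le)
    also have "card (I - J) \<le> card ({0..<k} \<union> {int N + k<..int N})"
      by (rule card_mono) (auto simp: I_def J_def)
    also have "\<dots> \<le> card {0..<k} + card {int N + k<..int N}" by (rule card_Un_le)
    also have "\<dots> = nat \<bar>k\<bar>" by auto
    also have "card (J - I) \<le> card ({k..<0} \<union> {int N<..int N + k})"
      by (rule card_mono) (auto simp: I_def J_def)
    also have "\<dots> \<le> card {k..<0} + card {int N<..int N + k}" by (rule card_Un_le)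
    also have "\<dots> = nat \<bar>k\<bar>" by auto
    finally show ?thesis by simp
  qed
  have F: "finite F" unfolding F_def by (rule finite_vec_box) (use fin in auto)
  have cF: "card F = card D * Suc N ^ (CARD('a) - 1)"
  proof -
    have "card F = (\<Prod>l\<in>UNIV. card (if l = i then D else I))"
      unfolding F_def by (rule card_vec_box) (use fin in auto)
    also have "\<dots> = card D * (\<Prod>l\<in>UNIV-{i}. card (if l = i then D else I))"
      by (subst prod.remove[of _ i]) auto
    also have "(\<Prod>l\<in>UNIV-{i}. card (if l = i then D else I)) = (\<Prod>l\<in>UNIV-{i}. Suc N)"
      by (rule prod.cong) (auto simp: I_def)
    finally show ?thesis by (simp add: card_Diff_singleton)
  qed
  have c: "c = real (Suc N) * real (Suc N) ^ (CARD('a) - 1)"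
    unfolding c_def card_lattice_box
    by (metis One_nat_def Suc_pred' of_nat_mult of_nat_power power_Suc zero_less_card_finite)
  have u: "?u n = complex_of_real ((indicator (lattice_box N) (n - axis i k) - indicator (lattice_box N) n) / sqrt c)
      * (cis (- (\<theta> i * of_int k)) * plane_wave \<theta> n)" for n
    unfolding shift_def weyl_def plane_wave_shift c_def
    by (simp add: algebra_simps diff_divide_distrib)
  have out: "indicator (lattice_box N) (n - axis i k) = (indicator (lattice_box N) n :: real)" if nF: "n \<notin> F" for n :: "int ^ 'a"
  proof -
    have "(n - axis i k) $ l = (if l = i then n $ l - k else n $ l)" for l
      by (simp add: axis_def)
    then have "n - axis i k \<in> lattice_box N \<longleftrightarrow> (\<forall>l. (if l = i then n $ l \<in> J else n $ l \<in> I))"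
      unfolding lattice_box_def I_def J_def by (auto split: if_splits)
    moreover have "n \<in> lattice_box N \<longleftrightarrow> (\<forall>l. n $ l \<in> I)" by (simp add: lattice_box_def I_def)
    moreover obtain l where "n $ l \<notin> (if l = i then D else I)" using nF by (auto simp: F_def)
    ultimately show ?thesis by (auto simp: indicator_def D_def split: if_splits)
  qed
  have "(ell2_norm ?u)\<^sup>2 = (\<Sum>n\<in>F. (cmod (?u n))\<^sup>2)"
    by (rule comp_supp_norm[OF F]) (simp only: u, simp add: out)
  also have "\<dots> \<le> (\<Sum>n\<in>F. 1 / c)"
  proof (rule sum_mono)
    fix n
    have "\<bar>indicator (lattice_box N) (n - axis i k) - indicator (lattice_box N) n\<bar> \<le> (1 :: real)"
      by (simp add: indicator_def)
    then have "(indicator (lattice_box N) (n - axis i k) - indicator (lattice_box N) n)\<^sup>2 \<le> (1 :: real)"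
      by (simp add: abs_square_le_1)
    then show "(cmod (?u n))\<^sup>2 \<le> 1 / c"
      unfolding u norm_mult norm_of_real norm_cis cmod_plane_wave
      by (simp add: power_divide c_def divide_right_mono)
  qed
  also have "\<dots> = real (card D) / real (Suc N)"
    by (simp add: cF c)
  also have "\<dots> \<le> 2 * \<bar>real_of_int k\<bar> / real (Suc N)"
  proof (rule divide_right_mono)
    have "int (card D) \<le> 2 * \<bar>k\<bar>" using cD by linarith
    then have "real_of_int (int (card D)) \<le> real_of_int (2 * \<bar>k\<bar>)" by (simp only: of_int_le_iff)
    then show "real (card D) \<le> 2 * \<bar>real_of_int k\<bar>" by simp
  qed simp
  finally show ?thesis by (rule real_le_rsqrt)
qed

text \<open>
  With contractions, the approximate eigenvalues along a fixed sequence behave like a character: they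
  are compatible with combinations and compositions.
\<close>

definition approx_eigen ::
  "(nat \<Rightarrow> 'a \<Rightarrow> complex) \<Rightarrow> (('a \<Rightarrow> complex) \<Rightarrow> ('a \<Rightarrow> complex)) \<Rightarrow> complex \<Rightarrow> bool" where
  "approx_eigen U F c \<longleftrightarrow> contraction F \<and> (\<lambda>N. ell2_norm (\<lambda>n. F (U N) n - c * U N n)) \<longlonglongrightarrow> 0"

lemma approx_eigen_mix:
  assumes U: "\<And>N. U N \<in> ell2" and F: "approx_eigen U F c" and G: "approx_eigen U G d"
    and ab: "cmod a + cmod b \<le> 1"
  shows "approx_eigen U (\<lambda>u n. a * F u n + b * G u n) (a * c + b * d)"
proof -
  have con: "contraction F" "contraction G" using F G by (auto simp: approx_eigen_def)
  let ?r = "\<lambda>N n. F (U N) n - c * U N n" and ?s = "\<lambda>N n. G (U N) n - d * U N n"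
  have mem: "?r N \<in> ell2" "?s N \<in> ell2" for N
    by (simp_all add: ell2_diff ell2_scale contraction_ell2 con U)
  have "(\<lambda>N. cmod a * ell2_norm (?r N) + cmod b * ell2_norm (?s N)) \<longlonglongrightarrow> cmod a * 0 + cmod b * 0"
    by (intro tendsto_intros) (use F G in \<open>auto simp: approx_eigen_def\<close>)
  then have lim: "(\<lambda>N. cmod a * ell2_norm (?r N) + cmod b * ell2_norm (?s N)) \<longlonglongrightarrow> 0" by simp
  have "(\<lambda>N. ell2_norm (\<lambda>n. a * F (U N) n + b * G (U N) n - (a * c + b * d) * U N n)) \<longlonglongrightarrow> 0"
  proof (rule Lim_null_comparison[OF _ lim], intro always_eventually allI)
    fix N
    have "(\<lambda>n. a * F (U N) n + b * G (U N) n - (a * c + b * d) * U N n) = (\<lambda>n. a * ?r N n + b * ?s N n)"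
      by (simp add: fun_eq_iff algebra_simps)
    then show "norm (ell2_norm (\<lambda>n. a * F (U N) n + b * G (U N) n - (a * c + b * d) * U N n))
        \<le> cmod a * ell2_norm (?r N) + cmod b * ell2_norm (?s N)"
      using ell2_lincomb(2)[OF mem] by simp
  qed
  then show ?thesis by (simp add: approx_eigen_def contraction_mix con ab)
qed

lemma approx_eigen_comp:
  assumes U: "\<And>N. U N \<in> ell2" and F: "approx_eigen U F c" and G: "approx_eigen U G d"
  shows "approx_eigen U (\<lambda>u. F (G u)) (c * d)"
proof -
  have con: "contraction F" "contraction G" using F G by (auto simp: approx_eigen_def)
  let ?r = "\<lambda>N n. F (U N) n - c * U N n" and ?s = "\<lambda>N n. G (U N) n - d * U N n"
  have mem: "?r N \<in> ell2" "?s N \<in> ell2" for N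
    by (simp_all add: ell2_diff ell2_scale contraction_ell2 con U)
  have "(\<lambda>N. ell2_norm (?s N) + cmod d * ell2_norm (?r N)) \<longlonglongrightarrow> 0 + cmod d * 0"
    by (intro tendsto_intros) (use F G in \<open>auto simp: approx_eigen_def\<close>)
  then have lim: "(\<lambda>N. ell2_norm (?s N) + cmod d * ell2_norm (?r N)) \<longlonglongrightarrow> 0" by simp
  have "(\<lambda>N. ell2_norm (\<lambda>n. F (G (U N)) n - (c * d) * U N n)) \<longlonglongrightarrow> 0"
  proof (rule Lim_null_comparison[OF _ lim], intro always_eventually allI)
    fix N
    have "F (?s N) = (\<lambda>n. F (G (U N)) n - d * F (U N) n)"
      using contraction_linear[OF con(1), of 1 "G (U N)" "-d" "U N"] by simp
    then have "(\<lambda>n. F (G (U N)) n - (c * d) * U N n) = (\<lambda>n. 1 * F (?s N) n + d * ?r N n)"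
      by (simp add: fun_eq_iff algebra_simps)
    then have "ell2_norm (\<lambda>n. F (G (U N)) n - (c * d) * U N n)
        \<le> ell2_norm (F (?s N)) + cmod d * ell2_norm (?r N)"
      using ell2_lincomb(2)[OF contraction_ell2[OF con(1) mem(2)] mem(1), of 1 N d N] by simp
    then show "norm (ell2_norm (\<lambda>n. F (G (U N)) n - (c * d) * U N n))
        \<le> ell2_norm (?s N) + cmod d * ell2_norm (?r N)"
      using contraction_norm[OF con(1) mem(2), of N] by simp
  qed
  then show ?thesis by (simp add: approx_eigen_def contraction_comp con)
qed

lemma approx_eigen_shift: "approx_eigen (weyl \<theta>) (shift i k) (cis (- (\<theta> i * of_int k)))"
proof -
  have "(\<lambda>N. sqrt (2 * \<bar>real_of_int k\<bar> / real (Suc N))) \<longlonglongrightarrow> sqrt 0"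
    by (intro tendsto_real_sqrt LIMSEQ_Suc lim_const_over_n)
  then have lim: "(\<lambda>N. sqrt (2 * \<bar>real_of_int k\<bar> / real (Suc N))) \<longlonglongrightarrow> 0" by simp
  have "(\<lambda>N. ell2_norm (\<lambda>n. shift i k (weyl \<theta> N) n - cis (- (\<theta> i * of_int k)) * weyl \<theta> N n)) \<longlonglongrightarrow> 0"
    by (rule Lim_null_comparison[OF _ lim], intro always_eventually allI)
      (use weyl_shift_defect in simp)
  then show ?thesis by (simp add: approx_eigen_def contraction_shift)
qed

lemma approx_eigen_Delta: "approx_eigen (weyl \<theta>) (Delta i) (complex_of_real (cos (\<theta> i)))"
proof -
  have "Delta i = (\<lambda>u n. 1/2 * shift i 1 u n + 1/2 * shift i (-1) u n)"
    by (rule ext) (rule Delta_eq_mix)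
  moreover have "approx_eigen (weyl \<theta>) (\<lambda>u n. 1/2 * shift i 1 u n + 1/2 * shift i (-1) u n)
      (1/2 * cis (- (\<theta> i * of_int 1)) + 1/2 * cis (- (\<theta> i * of_int (-1))))"
    by (intro approx_eigen_mix approx_eigen_shift weyl_ell2) simp
  moreover have "1/2 * cis (- (\<theta> i * of_int 1)) + 1/2 * cis (- (\<theta> i * of_int (-1)))
      = complex_of_real (cos (\<theta> i))"
    by (simp add: complex_eq_iff)
  ultimately show ?thesis by simp
qed

lemma approx_eigen_half_diff:
  "approx_eigen (weyl \<theta>) (half_diff i p) (- \<i> * complex_of_real (sin (real p * \<theta> i)))"
proof -
  have "half_diff i p = (\<lambda>u n. 1/2 * shift i (int p) u n + (-1/2) * shift i (- int p) u n)"
    by (simp add: fun_eq_iff half_diff_def)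
  moreover have "approx_eigen (weyl \<theta>) (\<lambda>u n. 1/2 * shift i (int p) u n + (-1/2) * shift i (- int p) u n)
      (1/2 * cis (- (\<theta> i * of_int (int p))) + (-1/2) * cis (- (\<theta> i * of_int (- int p))))"
    by (intro approx_eigen_mix approx_eigen_shift weyl_ell2) simp
  moreover have "1/2 * cis (- (\<theta> i * of_int (int p))) + (-1/2) * cis (- (\<theta> i * of_int (- int p)))
      = - \<i> * complex_of_real (sin (real p * \<theta> i))"
    by (simp add: complex_eq_iff mult.commute)
  ultimately show ?thesis by simp
qed

lemma approx_eigen_Delta_prod:
  "approx_eigen (weyl \<theta>) (Delta_prod A) (complex_of_real (\<Prod>l\<in>A. cos (\<theta> l)))"
proof (induction A rule: finite_induct[OF finite])
  case 1
  have "contraction (\<lambda>u :: 'a lattice_fun. u)" by (simp add: contraction_def)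
  then show ?case by (simp add: approx_eigen_def Delta_prod_empty ell2_zero)
next
  case (2 i A)
  then have "Delta_prod (insert i A) = (\<lambda>u. Delta i (Delta_prod A u))"
    by (auto simp: Delta_prod_insert fun_eq_iff)
  then show ?case
    using approx_eigen_comp[OF weyl_ell2 approx_eigen_Delta 2(3), of i] 2 by simp
qed

lemma approx_eigen_comm_dir:
  "approx_eigen (weyl \<theta>) (comm_dir i p)
     (- complex_of_real ((\<Prod>l\<in>UNIV - {i}. cos (\<theta> l)) * sin (\<theta> i) * sin (real p * \<theta> i)))"
proof -
  have "comm_dir i p = (\<lambda>u. half_diff i p (half_diff i 1 (Delta_prod (UNIV - {i}) u)))"
    by (simp add: fun_eq_iff comm_dir_def)
  moreover have "approx_eigen (weyl \<theta>)
      (\<lambda>u. half_diff i p (half_diff i 1 (Delta_prod (UNIV - {i}) u)))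
      ((- \<i> * complex_of_real (sin (real p * \<theta> i))) *
       ((- \<i> * complex_of_real (sin (real 1 * \<theta> i))) * complex_of_real (\<Prod>l\<in>UNIV - {i}. cos (\<theta> l))))"
    by (rule approx_eigen_comp[OF weyl_ell2 approx_eigen_half_diff
        approx_eigen_comp[OF weyl_ell2 approx_eigen_half_diff approx_eigen_Delta_prod]])
  moreover have "(- \<i> * complex_of_real (sin (real p * \<theta> i))) *
      ((- \<i> * complex_of_real (sin (real 1 * \<theta> i))) * complex_of_real (\<Prod>l\<in>UNIV - {i}. cos (\<theta> l)))
    = - complex_of_real ((\<Prod>l\<in>UNIV - {i}. cos (\<theta> l)) * sin (\<theta> i) * sin (real p * \<theta> i))"
    by (simp add: complex_eq_iff algebra_simps)
  ultimately show ?thesis by (simp only:)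
qed

lemma approx_eigen_inner:
  assumes U: "\<And>N. U N \<in> ell2" "\<And>N. ell2_norm (U N) = 1" and F: "approx_eigen U F c"
  shows "(\<lambda>N. ell2_inner (U N) (F (U N))) \<longlonglongrightarrow> c"
proof -
  have con: "contraction F" and lim: "(\<lambda>N. ell2_norm (\<lambda>n. F (U N) n - c * U N n)) \<longlonglongrightarrow> 0"
    using F by (auto simp: approx_eigen_def)
  have "(\<lambda>N. ell2_inner (U N) (F (U N)) - c) \<longlonglongrightarrow> 0"
  proof (rule Lim_null_comparison[OF _ lim], intro always_eventually allI)
    fix N
    have "ell2_inner (U N) (F (U N)) - c = ell2_inner (U N) (\<lambda>n. F (U N) n - c * U N n)"
      by (simp add: ell2_inner_diff_right ell2_scale contraction_ell2[OF con] U
          ell2_inner_scale_right ell2_inner_self)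
    also have "norm \<dots> \<le> ell2_norm (U N) * ell2_norm (\<lambda>n. F (U N) n - c * U N n)"
      by (rule ell2_Cauchy_Schwarz) (simp_all add: ell2_diff ell2_scale contraction_ell2[OF con] U)
    finally show "norm (ell2_inner (U N) (F (U N)) - c) \<le> ell2_norm (\<lambda>n. F (U N) n - c * U N n)"
      by (simp add: U)
  qed
  then show ?thesis by (rule LIM_zero_cancel)
qed

lemma g_fun_cos:
  fixes x :: "real ^ 'd::finite"
  assumes "\<And>i. x $ i = cos (\<theta> i)" "1 \<le> p"
  shows "g_fun p x = (\<Sum>i\<in>UNIV. (\<Prod>l\<in>UNIV - {i}. cos (\<theta> l)) * sin (\<theta> i) * sin (real p * \<theta> i))"
  unfolding g_fun_def
proof (rule sum.cong[OF refl])
  fix i :: 'd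
  have "1 - (x $ i)\<^sup>2 = sin (\<theta> i) * sin (\<theta> i)"
    using sin_squared_eq[of "\<theta> i"] by (simp add: assms(1) power2_eq_square)
  then have "(1 - (x $ i)\<^sup>2) * cheb_U (p - 1) (x $ i) = sin (\<theta> i) * (sin (\<theta> i) * cheb_U (p - 1) (cos (\<theta> i)))"
    by (simp add: assms(1))
  also have "\<dots> = sin (\<theta> i) * sin (real p * \<theta> i)"
    using assms(2) by (simp add: cheb_U_cos)
  finally show "(\<Prod>l\<in>UNIV - {i}. x $ l) * (1 - (x $ i)\<^sup>2) * cheb_U (p - 1) (x $ i)
      = (\<Prod>l\<in>UNIV - {i}. cos (\<theta> l)) * sin (\<theta> i) * sin (real p * \<theta> i)"
    by (simp add: assms(1) mult.assoc)
qed

section \<open>Localisation by the spectral measure\<close>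

text \<open>
  The defining property of the spectral measure concerns quadratic forms only. What is extracted from it
  is that a vector almost annihilated by \<open>T - E\<close> is almost fixed by \<open>P I\<close> for \<open>I\<close> a neighbourhood of
  \<open>E\<close>. This avoids the functional calculus, in particular the identity
  \<open>\<parallel>(T - E) u\<parallel>\<^sup>2 = \<integral> (t - E)\<^sup>2 d\<parallel>P u\<parallel>\<^sup>2\<close>.
\<close>

locale spectral_resolution =
  fixes T :: "('a \<Rightarrow> complex) \<Rightarrow> ('a \<Rightarrow> complex)"
    and P :: "real set \<Rightarrow> ('a \<Rightarrow> complex) \<Rightarrow> ('a \<Rightarrow> complex)"
  assumes contr: "contraction T" and spectral: "spectral_measure T P"
begin

lemma projection: "M \<in> sets borel \<Longrightarrow> orth_projection (P M)"
  using spectral by (simp add: spectral_measure_def)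

lemma P_ell2: "M \<in> sets borel \<Longrightarrow> u \<in> ell2 \<Longrightarrow> P M u \<in> ell2"
  using projection[of M] by (simp add: orth_projection_def bounded_op_def)

lemma P_lincomb: "M \<in> sets borel \<Longrightarrow> u \<in> ell2 \<Longrightarrow> v \<in> ell2 \<Longrightarrow>
    P M (\<lambda>n. a * u n + b * v n) = (\<lambda>n. a * P M u n + b * P M v n)"
  using projection[of M] by (simp add: orth_projection_def bounded_op_def)

lemma P_idem: "M \<in> sets borel \<Longrightarrow> u \<in> ell2 \<Longrightarrow> P M (P M u) = P M u"
  using projection[of M] by (simp add: orth_projection_def)

lemma P_symmetric: "M \<in> sets borel \<Longrightarrow> u \<in> ell2 \<Longrightarrow> v \<in> ell2 \<Longrightarrow>
    ell2_inner (P M u) v = ell2_inner u (P M v)"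
  using projection[of M] by (simp add: orth_projection_def)

lemma P_UNIV: "u \<in> ell2 \<Longrightarrow> P UNIV u = u"
  using spectral by (simp add: spectral_measure_def)

lemma P_countable:
  fixes M :: "nat \<Rightarrow> real set"
  assumes "range M \<subseteq> sets borel" "disjoint_family M" "u \<in> ell2"
  shows "ell2_tendsto (\<lambda>K n. \<Sum>k<K. P (M k) u n) (P (\<Union>k. M k) u)"
  using spectral assms unfolding spectral_measure_def by blast

text \<open>
  For the constant sequence of empty sets, the partial sums \<open>K P({}) u\<close> can converge only if
  \<open>P({}) u = 0\<close>.
\<close>

lemma P_empty:
  assumes "u \<in> ell2" shows "P {} u = (\<lambda>n. 0)"
proof
  fix n
  have "ell2_tendsto (\<lambda>K n. \<Sum>k<K. P {} u n) (P (\<Union>k::nat. {}) u)"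
    by (rule P_countable) (auto simp: assms disjoint_family_on_def)
  then have lim: "(\<lambda>K::nat. of_nat K * P {} u n) \<longlonglongrightarrow> P {} u n"
    using ell2_tendsto_pointwise by fastforce
  have "(\<lambda>K. of_nat (Suc K) * P {} u n - of_nat K * P {} u n) \<longlonglongrightarrow> P {} u n - P {} u n"
    by (rule tendsto_diff[OF LIMSEQ_Suc[OF lim] lim])
  then show "P {} u n = 0"
    by (simp add: algebra_simps LIMSEQ_const_iff)
qed

lemma P_union:
  assumes "M \<in> sets borel" "M' \<in> sets borel" "M \<inter> M' = {}" "u \<in> ell2"
  shows "P (M \<union> M') u = (\<lambda>n. P M u n + P M' u n)"
proof
  fix n
  define S :: "nat \<Rightarrow> real set" where "S = (\<lambda>k. if k = 0 then M else if k = 1 then M' else {})"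
  have U: "(\<Union>k. S k) = M \<union> M'" by (auto simp: S_def split: if_splits)
  have "ell2_tendsto (\<lambda>K n. \<Sum>k<K. P (S k) u n) (P (\<Union>k. S k) u)"
    by (rule P_countable) (use assms in \<open>auto simp: S_def disjoint_family_on_def\<close>)
  then have lim: "(\<lambda>K. \<Sum>k<K. P (S k) u n) \<longlonglongrightarrow> P (M \<union> M') u n"
    unfolding U by (rule ell2_tendsto_pointwise)
  have "(\<Sum>k<K. P (S k) u n) = P M u n + P M' u n" if "2 \<le> K" for K
  proof -
    have "(\<Sum>k<K. P (S k) u n) = (\<Sum>k\<in>{0,1}. P (S k) u n)"
      by (rule sum.mono_neutral_right) (use that in \<open>auto simp: S_def P_empty assms\<close>)
    then show ?thesis by (simp add: S_def)
  qed
  then have "\<forall>\<^sub>F K in sequentially. (\<Sum>k<K. P (S k) u n) = P M u n + P M' u n"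
    by (intro eventually_sequentiallyI[of 2])
  then have "(\<lambda>K. \<Sum>k<K. P (S k) u n) \<longlonglongrightarrow> P M u n + P M' u n"
    by (rule tendsto_eventually)
  then show "P (M \<union> M') u n = P M u n + P M' u n"
    by (rule LIMSEQ_unique[OF lim])
qed

text \<open>
  If a sum of two projections is idempotent, then the two anticommute, and anticommuting projections
  have product zero.
\<close>

lemma P_disjoint:
  assumes M: "M \<in> sets borel" and M': "M' \<in> sets borel" and dis: "M \<inter> M' = {}" and u: "u \<in> ell2"
  shows "P M (P M' u) = (\<lambda>n. 0)"
proof -
  have anti: "P M (P M' v) n + P M' (P M v) n = 0" if v: "v \<in> ell2" for v n
  proof -
    note mem = P_ell2[OF M v] P_ell2[OF M' v]
    have B: "M \<union> M' \<in> sets borel" using M M' by auto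
    have un: "P (M \<union> M') w = (\<lambda>n. 1 * P M w n + 1 * P M' w n)" if "w \<in> ell2" for w
      using P_union[OF M M' dis that] by simp
    have "P (M \<union> M') (P (M \<union> M') v) = (\<lambda>n. 1 * P (M \<union> M') (P M v) n + 1 * P (M \<union> M') (P M' v) n)"
      unfolding un[OF v] by (rule P_lincomb[OF B mem])
    then have "P (M \<union> M') v n = P (M \<union> M') (P M v) n + P (M \<union> M') (P M' v) n"
      by (simp add: P_idem[OF B v])
    then show ?thesis
      by (simp add: un mem v P_idem[OF M v] P_idem[OF M' v] add.commute)
  qed
  note mem = P_ell2[OF M u] P_ell2[OF M' u]
  \<comment> \<open>Multiplying the anticommutation relation by \<open>P M\<close> from the left gives \<open>P M P M' P M = - P M P M'\<close>, from the right \<open>P M P M' P M = - P M' P M\<close>.\<close>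
  have a: "P M' (P M u) = (\<lambda>n. (-1) * P M (P M' u) n + 0 * u n)"
    using anti[OF u] by (simp add: fun_eq_iff eq_neg_iff_add_eq_0 add.commute)
  have "P M (P M' (P M u)) = (\<lambda>n. (-1) * P M (P M (P M' u)) n + 0 * P M u n)"
    unfolding a by (intro P_lincomb M P_ell2 M' u)
  then have "P M (P M' (P M u)) n = - P M (P M' u) n" for n
    by (simp add: P_idem[OF M mem(2)])
  moreover have "P M (P M' (P M u)) n + P M' (P M u) n = 0" for n
    using anti[OF mem(1), of n] by (simp add: P_idem[OF M u])
  ultimately have "P M' (P M u) n = P M (P M' u) n" for n
    by (metis add.commute add_eq_0_iff minus_minus)
  with anti[OF u] show ?thesis by (simp add: fun_eq_iff)
qed

lemma P_quadratic:
  assumes "M \<in> sets borel" "u \<in> ell2"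
  shows "ell2_inner u (P M u) = complex_of_real ((ell2_norm (P M u))\<^sup>2)"
  using P_symmetric[OF assms(1,2) P_ell2[OF assms]] by (simp add: P_idem P_ell2 assms ell2_inner_self)

lemma space_scalar_measure [simp]: "space (scalar_spectral_measure P u) = UNIV"
  by (simp add: scalar_spectral_measure_def space_measure_of_conv)

lemma sets_scalar_measure [simp]: "sets (scalar_spectral_measure P u) = sets borel"
  unfolding scalar_spectral_measure_def
  by (metis sets.sigma_sets_eq sets_measure_of space_borel subset_UNIV Pow_UNIV)

lemma emeasure_scalar_measure:
  assumes u: "u \<in> ell2" and M: "M \<in> sets borel"
  shows "emeasure (scalar_spectral_measure P u) M = ennreal ((ell2_norm (P M u))\<^sup>2)"
proof (rule emeasure_measure_of[OF scalar_spectral_measure_def])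
  show "positive (sets (scalar_spectral_measure P u)) (\<lambda>M. ennreal ((ell2_norm (P M u))\<^sup>2))"
    by (simp add: positive_def P_empty u ell2_zero)
  show "countably_additive (sets (scalar_spectral_measure P u)) (\<lambda>M. ennreal ((ell2_norm (P M u))\<^sup>2))"
  proof (rule countably_additiveI)
    fix A :: "nat \<Rightarrow> real set"
    assume "range A \<subseteq> sets (scalar_spectral_measure P u)" and dis: "disjoint_family A"
    then have A: "range A \<subseteq> sets borel" by simp
    then have Ak: "A k \<in> sets borel" for k by auto
    have UA: "(\<Union>k. A k) \<in> sets borel" using Ak by auto
    have "(\<lambda>K. ell2_inner u (\<lambda>n. \<Sum>k<K. P (A k) u n)) \<longlonglongrightarrow> ell2_inner u (P (\<Union>k. A k) u)"
      by (rule ell2_tendsto_inner[OF P_countable[OF A dis u] u])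
    moreover have "(\<lambda>n. \<Sum>k<K. P (A k) u n) \<in> ell2 \<and>
        ell2_inner u (\<lambda>n. \<Sum>k<K. P (A k) u n) = complex_of_real (\<Sum>k<K. (ell2_norm (P (A k) u))\<^sup>2)" for K
    proof (induction K)
      case 0
      then show ?case by (simp add: ell2_zero ell2_inner_def)
    next
      case (Suc K)
      then show ?case
        by (simp add: ell2_add ell2_inner_add_right P_ell2 Ak u P_quadratic)
    qed
    ultimately have "(\<lambda>K. complex_of_real (\<Sum>k<K. (ell2_norm (P (A k) u))\<^sup>2))
        \<longlonglongrightarrow> complex_of_real ((ell2_norm (P (\<Union>k. A k) u))\<^sup>2)"
      by (simp only: P_quadratic[OF UA u])
    then have "(\<lambda>k. (ell2_norm (P (A k) u))\<^sup>2) sums (ell2_norm (P (\<Union>k. A k) u))\<^sup>2"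
      by (simp only: tendsto_of_real_iff sums_def)
    then show "(\<Sum>k. ennreal ((ell2_norm (P (A k) u))\<^sup>2)) = ennreal ((ell2_norm (P (\<Union>k. A k) u))\<^sup>2)"
      by (intro suminf_ennreal_eq) auto
  qed
qed (use M in auto)

lemma finite_scalar_measure:
  assumes "u \<in> ell2"
  shows "finite_measure (scalar_spectral_measure P u)"
  by (rule finite_measureI) (simp add: emeasure_scalar_measure assms)

lemma quadratic_form:
  assumes "u \<in> ell2"
  shows "integrable (scalar_spectral_measure P u) (\<lambda>t. t)"
    and "ell2_inner u (T u) = complex_of_real (\<integral>t. t \<partial>scalar_spectral_measure P u)"
  using spectral assms by (auto simp: spectral_measure_def)

lemma measure_scalar_measure_UNIV:
  assumes "u \<in> ell2"
  shows "measure (scalar_spectral_measure P u) UNIV = (ell2_norm u)\<^sup>2"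
  by (simp add: measure_def emeasure_scalar_measure assms P_UNIV)

lemma AE_scalar_measure:
  assumes S: "S \<in> sets borel" and u: "u \<in> ell2"
  shows "AE t in scalar_spectral_measure P (P S u). t \<in> S"
proof (rule AE_I)
  have mS: "- S \<in> sets borel" using S by auto
  show "{t \<in> space (scalar_spectral_measure P (P S u)). t \<notin> S} \<subseteq> - S" by auto
  show "emeasure (scalar_spectral_measure P (P S u)) (- S) = 0"
    by (simp add: emeasure_scalar_measure P_ell2 S mS u P_disjoint ell2_zero)
  show "- S \<in> sets (scalar_spectral_measure P (P S u))" using mS by simp
qed

lemma quadratic_form_lower:
  assumes S: "S \<in> sets borel" and u: "u \<in> ell2" and le: "\<And>t. t \<in> S \<Longrightarrow> c \<le> t"
  shows "c * (ell2_norm (P S u))\<^sup>2 \<le> Re (ell2_inner (P S u) (T (P S u)))"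
proof -
  let ?m = "scalar_spectral_measure P (P S u)"
  interpret finite_measure ?m by (rule finite_scalar_measure) (rule P_ell2[OF S u])
  have "(\<integral>t. c \<partial>?m) \<le> (\<integral>t. t \<partial>?m)"
  proof (rule integral_mono_AE)
    show "integrable ?m (\<lambda>t. t)" by (rule quadratic_form(1)[OF P_ell2[OF S u]])
    show "AE t in ?m. c \<le> t" using AE_scalar_measure[OF S u] by eventually_elim (rule le)
  qed simp
  then show ?thesis
    by (simp add: quadratic_form(2) P_ell2[OF S u] measure_scalar_measure_UNIV mult.commute)
qed

lemma quadratic_form_upper:
  assumes S: "S \<in> sets borel" and u: "u \<in> ell2" and le: "\<And>t. t \<in> S \<Longrightarrow> t \<le> c"
  shows "Re (ell2_inner (P S u) (T (P S u))) \<le> c * (ell2_norm (P S u))\<^sup>2"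
proof -
  let ?m = "scalar_spectral_measure P (P S u)"
  interpret finite_measure ?m by (rule finite_scalar_measure) (rule P_ell2[OF S u])
  have "(\<integral>t. t \<partial>?m) \<le> (\<integral>t. c \<partial>?m)"
  proof (rule integral_mono_AE)
    show "integrable ?m (\<lambda>t. t)" by (rule quadratic_form(1)[OF P_ell2[OF S u]])
    show "AE t in ?m. t \<le> c" using AE_scalar_measure[OF S u] by eventually_elim (rule le)
  qed simp
  then show ?thesis
    by (simp add: quadratic_form(2) P_ell2[OF S u] measure_scalar_measure_UNIV mult.commute)
qed

text \<open>
  The scalar spectral measure of a sum of components in \<open>P S\<close> and \<open>P (-S)\<close> is blind to their relative
  phase.
\<close>

lemma ell2_norm_P_orthogonal:
  assumes S: "S \<in> sets borel" and M: "M \<in> sets borel" and u: "u \<in> ell2" and c: "cmod c = 1"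
  shows "(ell2_norm (P M (\<lambda>n. P S u n + c * P (- S) u n)))\<^sup>2
       = (ell2_norm (P M (P S u)))\<^sup>2 + (ell2_norm (P M (P (- S) u)))\<^sup>2"
proof -
  have mS: "- S \<in> sets borel" using S by auto
  define v w where "v = P M (P S u)" and "w = P M (P (- S) u)"
  have vw: "v \<in> ell2" "w \<in> ell2" unfolding v_def w_def by (intro P_ell2 M S mS u)+
  have z: "ell2_inner v w = 0"
  proof -
    define x where "x = P (- S) u"
    have x: "x \<in> ell2" unfolding x_def by (intro P_ell2 mS u)
    have MS: "M \<inter> S \<in> sets borel" "M - S \<in> sets borel" using M S by auto
    have "w = P ((M \<inter> S) \<union> (M - S)) x" by (simp add: w_def x_def Int_Diff_Un)
    also have "\<dots> = (\<lambda>n. P (M \<inter> S) x n + P (M - S) x n)" by (rule P_union) (use MS x in auto)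
    also have "P (M \<inter> S) x = (\<lambda>n. 0)" unfolding x_def by (rule P_disjoint) (use MS mS u in auto)
    finally have w: "w = P (M - S) x" by simp
    have "ell2_inner v w = ell2_inner (P S u) (P M w)"
      unfolding v_def by (intro P_symmetric M P_ell2 S u vw)
    also have "P M w = w" unfolding w_def by (intro P_idem M P_ell2 mS u)
    also have "ell2_inner (P S u) w = ell2_inner u (P S w)" by (intro P_symmetric S u vw)
    also have "P S w = (\<lambda>n. 0)" unfolding w by (rule P_disjoint) (use S MS x in auto)
    finally show ?thesis by (simp add: ell2_inner_def)
  qed
  have z': "ell2_inner w v = 0" using ell2_inner_commute[of w v] z by simp
  have "P M (\<lambda>n. P S u n + c * P (- S) u n) = (\<lambda>n. 1 * v n + c * w n)"
    unfolding v_def w_def using P_lincomb[OF M P_ell2[OF S u] P_ell2[OF mS u], of 1 c] by simp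
  moreover have "complex_of_real ((ell2_norm (\<lambda>n. 1 * v n + c * w n))\<^sup>2)
      = complex_of_real ((ell2_norm v)\<^sup>2 + (ell2_norm w)\<^sup>2)"
  proof -
    have cc: "cnj c * c = 1" using c by (metis complex_norm_square mult.commute of_real_1 one_power2)
    have "complex_of_real ((ell2_norm (\<lambda>n. 1 * v n + c * w n))\<^sup>2)
        = ell2_inner (\<lambda>n. 1 * v n + c * w n) (\<lambda>n. 1 * v n + c * w n)"
      by (rule ell2_inner_self[symmetric, OF ell2_lincomb(1)[OF vw]])
    also have "\<dots> = ell2_inner v v + (cnj c * c) * ell2_inner w w"
      unfolding ell2_inner_lincomb_left[OF vw ell2_lincomb(1)[OF vw]]
        ell2_inner_lincomb_right[OF vw vw(1)] ell2_inner_lincomb_right[OF vw vw(2)]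
      by (simp add: z z' algebra_simps)
    finally show ?thesis by (simp add: cc ell2_inner_self vw)
  qed
  ultimately show ?thesis unfolding v_def w_def by (simp only: of_real_eq_iff)
qed

text \<open>
  The spectral subspaces reduce \<open>T\<close>. By the previous lemma, \<open>\<langle>v + c w, T (v + c w)\<rangle>\<close> with \<open>v\<close> in the
  range of \<open>P S\<close> and \<open>w\<close> in that of \<open>P (-S)\<close> takes the same value for \<open>c = 1, -1, \<i>, -\<i>\<close>; polarisation
  then makes both cross terms vanish.
\<close>

lemma P_reduces:
  assumes S: "S \<in> sets borel" and u: "u \<in> ell2"
  shows "ell2_inner (P S u) (T (P (- S) u)) = 0"
proof -
  have mS: "- S \<in> sets borel" using S by auto
  define v w where "v = P S u" and "w = P (- S) u"
  have vw: "v \<in> ell2" "w \<in> ell2" unfolding v_def w_def by (intro P_ell2 S mS u)+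
  have Tvw: "T v \<in> ell2" "T w \<in> ell2" by (simp_all add: contraction_ell2[OF contr] vw)
  define q where "q c = ell2_inner (\<lambda>n. v n + c * w n) (T (\<lambda>n. v n + c * w n))" for c
  have mem: "(\<lambda>n. v n + c * w n) \<in> ell2" for c by (intro ell2_add ell2_scale vw)
  have meas: "scalar_spectral_measure P (\<lambda>n. v n + c * w n) = scalar_spectral_measure P (\<lambda>n. v n + 1 * w n)"
    if "cmod c = 1" for c
  proof (rule measure_eqI)
    fix A assume "A \<in> sets (scalar_spectral_measure P (\<lambda>n. v n + c * w n))"
    then have A: "A \<in> sets borel" by simp
    show "emeasure (scalar_spectral_measure P (\<lambda>n. v n + c * w n)) A
        = emeasure (scalar_spectral_measure P (\<lambda>n. v n + 1 * w n)) A"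
      unfolding emeasure_scalar_measure[OF mem A] unfolding v_def w_def
      using ell2_norm_P_orthogonal[OF S A u that] ell2_norm_P_orthogonal[OF S A u, of 1] by simp
  qed simp
  have q: "q c = q 1" if "cmod c = 1" for c
    unfolding q_def quadratic_form(2)[OF mem] meas[OF that] ..
  have exp: "q c = ell2_inner v (T v) + c * ell2_inner v (T w) + cnj c * ell2_inner w (T v)
      + cnj c * c * ell2_inner w (T w)" for c
  proof -
    have "T (\<lambda>n. v n + c * w n) = (\<lambda>n. 1 * T v n + c * T w n)"
      using contraction_linear[OF contr, of 1 v c w] by simp
    then have "q c = ell2_inner (\<lambda>n. 1 * v n + c * w n) (\<lambda>n. 1 * T v n + c * T w n)"
      by (simp add: q_def)
    then show ?thesis
      unfolding ell2_inner_lincomb_left[OF vw ell2_lincomb(1)[OF Tvw]]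
        ell2_inner_lincomb_right[OF Tvw vw(1)] ell2_inner_lincomb_right[OF Tvw vw(2)]
      by (simp add: algebra_simps)
  qed
  have "q (-1) = q 1" "q \<i> = q 1" "q (-\<i>) = q 1" by (intro q; simp)+
  then have "q (-1) = q 1" "q \<i> = q (-\<i>)" by simp_all
  then have "2 * (ell2_inner v (T w) + ell2_inner w (T v)) = 0"
    and "2 * \<i> * (ell2_inner v (T w) - ell2_inner w (T v)) = 0"
    unfolding exp by (simp_all add: algebra_simps)
  then have e1: "ell2_inner v (T w) + ell2_inner w (T v) = 0"
    and "ell2_inner v (T w) = ell2_inner w (T v)" by auto
  with e1 show ?thesis by (simp add: v_def w_def)
qed

text \<open>
  On the range of \<open>P S\<close> the form of \<open>T - E\<close> is bounded away from zero with a fixed sign, and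
  \<open>\<langle>P S u, (T - E) u\<rangle> = \<langle>P S u, (T - E) P S u\<rangle>\<close> because the subspace is reducing. The
  Cauchy--Schwarz inequality concludes. Fixing the sign is why the two sides of \<open>E\<close> are treated
  separately.
\<close>

lemma P_away_bound:
  assumes S: "S \<in> sets borel" and u: "u \<in> ell2"
    and away: "(\<forall>t\<in>S. E + \<epsilon> \<le> t) \<or> (\<forall>t\<in>S. t \<le> E - \<epsilon>)"
  shows "\<epsilon> * ell2_norm (P S u) \<le> ell2_norm (\<lambda>n. T u n - complex_of_real E * u n)"
proof -
  have mS: "- S \<in> sets borel" using S by auto
  define v w where "v = P S u" and "w = P (- S) u"
  have vw: "v \<in> ell2" "w \<in> ell2" unfolding v_def w_def by (intro P_ell2 S mS u)+
  have Tvw: "T v \<in> ell2" "T w \<in> ell2" "T u \<in> ell2" by (simp_all add: contraction_ell2[OF contr] vw u)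
  let ?r = "\<lambda>n. T u n - complex_of_real E * u n"
  have r: "?r \<in> ell2" by (intro ell2_diff ell2_scale Tvw u)
  have "u = P (S \<union> - S) u" by (simp add: P_UNIV u)
  also have "\<dots> = (\<lambda>n. 1 * v n + 1 * w n)"
    unfolding v_def w_def using P_union[OF S mS _ u] by simp
  finally have u_eq: "u = (\<lambda>n. 1 * v n + 1 * w n)" .
  have "T u = (\<lambda>n. 1 * T v n + 1 * T w n)"
    by (subst u_eq) (rule contraction_linear[OF contr])
  then have "ell2_inner v (T u) = ell2_inner v (T v) + ell2_inner v (T w)"
    using ell2_inner_lincomb_right[OF Tvw(1,2) vw(1), of 1 1] by simp
  \<comment> \<open>The component of \<open>u\<close> outside the range of \<open>P S\<close> does not contribute.\<close>
  then have Tu: "ell2_inner v (T u) = ell2_inner v (T v)"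
    using P_reduces[OF S u] by (simp add: v_def w_def)
  have vu: "ell2_inner v u = complex_of_real ((ell2_norm v)\<^sup>2)"
    using P_quadratic[OF S u] P_symmetric[OF S u u] by (simp add: v_def)
  have ip: "ell2_inner v ?r = ell2_inner v (T v) - complex_of_real E * complex_of_real ((ell2_norm v)\<^sup>2)"
    using ell2_inner_diff_right[OF Tvw(3) ell2_scale[OF u] vw(1), of "complex_of_real E"]
    by (simp add: ell2_inner_scale_right Tu vu)
  have Re: "Re (ell2_inner v ?r) = Re (ell2_inner v (T v)) - E * (ell2_norm v)\<^sup>2"
    unfolding ip by (simp add: Re_complex_of_real[symmetric] del: Re_complex_of_real of_real_mult)
      (metis Re_complex_of_real minus_complex.simps(1) of_real_mult of_real_power)
  have "\<epsilon> * (ell2_norm v)\<^sup>2 \<le> \<bar>Re (ell2_inner v ?r)\<bar>"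
    using away
  proof
    assume "\<forall>t\<in>S. E + \<epsilon> \<le> t"
    then have "(E + \<epsilon>) * (ell2_norm v)\<^sup>2 \<le> Re (ell2_inner v (T v))"
      unfolding v_def by (intro quadratic_form_lower S u) auto
    then show ?thesis by (simp add: Re algebra_simps)
  next
    assume "\<forall>t\<in>S. t \<le> E - \<epsilon>"
    then have "Re (ell2_inner v (T v)) \<le> (E - \<epsilon>) * (ell2_norm v)\<^sup>2"
      unfolding v_def by (intro quadratic_form_upper S u) auto
    then show ?thesis by (simp add: Re algebra_simps)
  qed
  also have "\<dots> \<le> ell2_norm v * ell2_norm ?r"
    using abs_Re_le_cmod ell2_Cauchy_Schwarz[OF vw(1) r] order_trans by blast
  finally have "ell2_norm v * (\<epsilon> * ell2_norm v) \<le> ell2_norm v * ell2_norm ?r"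
    by (simp add: power2_eq_square algebra_simps)
  then have "\<epsilon> * ell2_norm v \<le> ell2_norm ?r" if "ell2_norm v \<noteq> 0"
    using that by (simp add: mult_le_cancel_left order_less_le)
  moreover have "\<epsilon> * ell2_norm v \<le> ell2_norm ?r" if "ell2_norm v = 0" using that by simp
  ultimately show ?thesis unfolding v_def by blast
qed

lemma P_localises:
  assumes I: "I \<in> sets borel" and u: "u \<in> ell2" and \<epsilon>: "0 < \<epsilon>"
    and near: "\<And>t. \<bar>t - E\<bar> < \<epsilon> \<Longrightarrow> t \<in> I"
  shows "\<epsilon> * ell2_norm (\<lambda>n. u n - P I u n) \<le> 2 * ell2_norm (\<lambda>n. T u n - complex_of_real E * u n)"
proof -
  define A B where "A = {E + \<epsilon>..} - I" and "B = {..E - \<epsilon>} - I"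
  have AB: "A \<in> sets borel" "B \<in> sets borel" using I by (auto simp: A_def B_def)
  have split: "- I = A \<union> B" "A \<inter> B = {}"
    using near \<epsilon> unfolding A_def B_def by (force simp: abs_if not_less split: if_splits)+
  have "P (I \<union> - I) u = (\<lambda>n. P I u n + P (- I) u n)" by (rule P_union) (use I u in auto)
  then have "(\<lambda>n. u n - P I u n) = P (- I) u" by (simp add: P_UNIV u fun_eq_iff)
  also have "\<dots> = (\<lambda>n. P A u n + P B u n)" unfolding split by (intro P_union AB split u)
  finally have "ell2_norm (\<lambda>n. u n - P I u n) \<le> ell2_norm (P A u) + ell2_norm (P B u)"
    using ell2_norm_triangle[OF P_ell2[OF AB(1) u] P_ell2[OF AB(2) u]] by simp
  then have "\<epsilon> * ell2_norm (\<lambda>n. u n - P I u n) \<le> \<epsilon> * (ell2_norm (P A u) + ell2_norm (P B u))"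
    using \<epsilon> by simp
  moreover have "\<epsilon> * ell2_norm (P A u) \<le> ell2_norm (\<lambda>n. T u n - complex_of_real E * u n)"
    by (rule P_away_bound[OF AB(1) u]) (auto simp: A_def)
  moreover have "\<epsilon> * ell2_norm (P B u) \<le> ell2_norm (\<lambda>n. T u n - complex_of_real E * u n)"
    by (rule P_away_bound[OF AB(2) u]) (auto simp: B_def)
  ultimately show ?thesis by (simp add: algebra_simps)
qed

end

section \<open>The symbol of the commutator and the thresholds\<close>

lemma weyl_energy_defect:
  "(\<lambda>N. ell2_norm (\<lambda>n. MV_D (weyl \<theta> N) n - complex_of_real (\<Prod>l\<in>UNIV. cos (\<theta> l)) * weyl \<theta> N n)) \<longlonglongrightarrow> 0"
  using approx_eigen_Delta_prod[of \<theta> UNIV] unfolding approx_eigen_def MV_D_eq_Delta_prod by simp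

text \<open>
  A bounded inverse of \<open>D - E\<close> would bound the norm \<open>1\<close> of the approximate eigenvectors by a null sequence.
\<close>

lemma energy_in_spectrum:
  fixes \<theta> :: "'d::finite \<Rightarrow> real"
  assumes E: "E = (\<Prod>l\<in>UNIV. cos (\<theta> l))"
  shows "complex_of_real E \<in> spectrum_op (MV_D :: 'd lattice_fun \<Rightarrow> 'd lattice_fun)"
proof (rule ccontr)
  assume "complex_of_real E \<notin> spectrum_op (MV_D :: 'd lattice_fun \<Rightarrow> 'd lattice_fun)"
  then obtain R where R: "bounded_op R"
    "\<And>u :: 'd lattice_fun. u \<in> ell2 \<Longrightarrow> R (\<lambda>n. MV_D u n - complex_of_real E * u n) = u"
    unfolding spectrum_op_def by blast
  then obtain C where C: "\<And>u :: 'd lattice_fun. u \<in> ell2 \<Longrightarrow> ell2_norm (R u) \<le> C * ell2_norm u"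
    unfolding bounded_op_def by blast
  let ?r = "\<lambda>N n. MV_D (weyl \<theta> N) n - complex_of_real E * weyl \<theta> N n"
  have "1 \<le> C * ell2_norm (?r N)" for N
  proof -
    have "?r N \<in> ell2"
      by (simp add: ell2_diff ell2_scale weyl_ell2 contraction_ell2[OF contraction_MV_D])
    from C[OF this] show ?thesis by (simp add: R(2) weyl_ell2 weyl_norm)
  qed
  moreover have "(\<lambda>N. C * ell2_norm (?r N)) \<longlonglongrightarrow> C * 0"
    unfolding E by (intro tendsto_mult tendsto_const weyl_energy_defect)
  ultimately have "1 \<le> C * 0" using LIMSEQ_le_const by blast
  then show False by simp
qed

definition unit_at :: "'a \<Rightarrow> 'a \<Rightarrow> complex" where
  "unit_at m n = (if n = m then 1 else 0)"

lemma unit_at_comp_supp: "unit_at m \<in> comp_supp"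
  by (simp add: comp_supp_def unit_at_def)

lemma inner_unit_at: "ell2_inner (unit_at m) v = v m"
  using comp_supp_inner[of "{m}" "unit_at m" v] by (simp add: unit_at_def)

text \<open>
  A self-adjoint graph is symmetric, so its values are determined by pairing with its domain.
\<close>

lemma selfadjoint_single_valued:
  assumes H: "selfadjoint H" and dom: "comp_supp \<subseteq> Domain H"
    and uv: "(u, v) \<in> H" "(u, v') \<in> H"
  shows "v = v'"
proof
  fix n
  have "unit_at n \<in> Domain H" by (rule subsetD[OF dom unit_at_comp_supp])
  then obtain y where y: "(unit_at n, y) \<in> H" by (rule DomainE)
  have "(u, v) \<in> op_adjoint H" "(u, v') \<in> op_adjoint H" using H uv by (simp_all add: selfadjoint_def)
  then have "ell2_inner v (unit_at n) = ell2_inner v' (unit_at n)"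
    using y unfolding op_adjoint_def by (metis (mono_tags, lifting) case_prodD mem_Collect_eq)
  then have "ell2_inner (unit_at n) v = ell2_inner (unit_at n) v'"
    by (simp add: ell2_inner_commute[of "unit_at n"])
  then show "v n = v' n" by (simp add: inner_unit_at)
qed

lemma lin_comb_core_limit:
  assumes "(u, v) \<in> lin_comb_core K \<rho>"
  shows "u \<in> comp_supp" "v \<in> ell2"
    "(\<lambda>J. \<Sum>j=1..J. complex_of_real (\<rho> (j * K)) * A_fun (j * K) u n) \<longlonglongrightarrow> v n"
proof -
  obtain w where w: "\<And>j. 1 \<le> j \<Longrightarrow> (u, w j) \<in> A_op (j * K)"
    and lim: "ell2_tendsto (\<lambda>J n. \<Sum>j=1..J. complex_of_real (\<rho> (j * K)) * w j n) v"
    and u: "u \<in> comp_supp"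
    using assms unfolding lin_comb_core_def by auto
  show "u \<in> comp_supp" "v \<in> ell2" using u lim by (auto simp: ell2_tendsto_def)
  have "w j = A_fun (j * K) u" if "1 \<le> j" for j by (rule A_op_eq[OF w[OF that]])
  then have "(\<Sum>j=1..J. complex_of_real (\<rho> (j * K)) * w j n)
      = (\<Sum>j=1..J. complex_of_real (\<rho> (j * K)) * A_fun (j * K) u n)" for J
    by (intro sum.cong) auto
  then show "(\<lambda>J. \<Sum>j=1..J. complex_of_real (\<rho> (j * K)) * A_fun (j * K) u n) \<longlonglongrightarrow> v n"
    using ell2_tendsto_pointwise[OF lim, of n] by simp
qed

lemma lin_comb_core_subset: "lin_comb_core K \<rho> \<subseteq> lin_comb K \<rho>"
proof
  fix z :: "'a lattice_fun \<times> 'a lattice_fun" assume z: "z \<in> lin_comb_core K \<rho>"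
  obtain u v where uv: "z = (u, v)" by fastforce
  have "u \<in> ell2" "v \<in> ell2"
    using lin_comb_core_limit(1,2)[of u v K \<rho>] z uv comp_supp_ell2 by auto
  then show "z \<in> lin_comb K \<rho>"
    using z unfolding uv lin_comb_def op_closure_def mem_Collect_eq case_prod_conv
    by (intro exI[of _ "\<lambda>k. u"] exI[of _ "\<lambda>k. v"]) (simp add: ell2_tendsto_const)
qed

text \<open>
  On compactly supported sequences the closed operator is still given by the series, because the
  closure is single-valued and the core is defined there already.
\<close>

lemma lin_comb_core_if_comp_supp:
  fixes H :: "('d::finite lattice_fun \<times> 'd lattice_fun) set"
  assumes sa: "selfadjoint_lin_comb K \<rho> H" and u: "u \<in> comp_supp" and uv: "(u, v) \<in> H"
  shows "(u, v) \<in> lin_comb_core K \<rho>"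
proof -
  have D: "Domain (lin_comb_core K \<rho> :: ('d lattice_fun \<times> 'd lattice_fun) set) = comp_supp"
    and H: "H = lin_comb K \<rho>" "selfadjoint H"
    using sa by (auto simp: selfadjoint_lin_comb_def)
  have "u \<in> Domain (lin_comb_core K \<rho> :: ('d lattice_fun \<times> 'd lattice_fun) set)" using D u by simp
  then obtain v' where v': "(u, v') \<in> lin_comb_core K \<rho>" by (rule DomainE)
  have "comp_supp \<subseteq> Domain H"
    unfolding D[symmetric] H(1) by (rule Domain_mono[OF lin_comb_core_subset])
  moreover have "(u, v') \<in> H" using subsetD[OF lin_comb_core_subset v'] H(1) by simp
  ultimately have "v = v'" by (rule selfadjoint_single_valued[OF H(2) _ uv])
  then show ?thesis using v' by simp
qed

text \<open>
  Both \<open>u\<close> and \<open>D u\<close> have compact support, so both terms of the commutator are series. As \<open>D\<close> is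
  local, it can be applied to the first of them term by term.
\<close>

lemma commutator_series:
  assumes sa: "selfadjoint_lin_comb K \<rho> H" and B: "bounded_commutator MV_D H B"
    and u: "u \<in> comp_supp"
  shows "(\<lambda>j. complex_of_real (\<rho> (Suc j * K)) * - (\<Sum>i\<in>UNIV. comm_dir i (Suc j * K) u n)) sums B u n"
proof -
  obtain v w where vw: "(u, v) \<in> H" "(MV_D u, w) \<in> H" and Bu: "B u = (\<lambda>n. \<i> * (MV_D v n - w n))"
    using B u unfolding bounded_commutator_def by blast
  note v = lin_comb_core_limit(3)[OF lin_comb_core_if_comp_supp[OF sa u vw(1)]]
  note w = lin_comb_core_limit(3)[OF lin_comb_core_if_comp_supp[OF sa comp_supp_MV_D[OF u] vw(2)]]
  let ?c = "\<lambda>j. complex_of_real (\<rho> (j * K))"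
  have "(\<lambda>J. MV_D (\<lambda>n. \<Sum>j=1..J. ?c j * A_fun (j * K) u n) n) \<longlonglongrightarrow> MV_D v n"
    unfolding MV_D_eq_Delta_prod by (rule Delta_prod_pointwise) (rule v)
  then have "(\<lambda>J. \<Sum>j=1..J. ?c j * MV_D (A_fun (j * K) u) n) \<longlonglongrightarrow> MV_D v n"
    by (simp add: contraction_sum[OF contraction_MV_D])
  then have "(\<lambda>J. \<i> * ((\<Sum>j=1..J. ?c j * MV_D (A_fun (j * K) u) n) -
      (\<Sum>j=1..J. ?c j * A_fun (j * K) (MV_D u) n))) \<longlonglongrightarrow> B u n"
    unfolding Bu by (intro tendsto_intros w)
  moreover have "\<i> * ((\<Sum>j=1..J. ?c j * MV_D (A_fun (j * K) u) n) -
      (\<Sum>j=1..J. ?c j * A_fun (j * K) (MV_D u) n))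
      = (\<Sum>j<J. ?c (Suc j) * - (\<Sum>i\<in>UNIV. comm_dir i (Suc j * K) u n))" for J
  proof -
    have "\<i> * ((\<Sum>j=1..J. ?c j * MV_D (A_fun (j * K) u) n) - (\<Sum>j=1..J. ?c j * A_fun (j * K) (MV_D u) n))
        = (\<Sum>j=1..J. ?c j * (\<i> * (MV_D (A_fun (j * K) u) n - A_fun (j * K) (MV_D u) n)))"
      unfolding sum_subtractf[symmetric] sum_distrib_left
      by (rule sum.cong) (simp_all add: algebra_simps)
    also have "\<dots> = (\<Sum>j=1..J. ?c j * - (\<Sum>i\<in>UNIV. comm_dir i (j * K) u n))"
      by (simp only: commutator_formula)
    also have "\<dots> = (\<Sum>j<J. ?c (Suc j) * - (\<Sum>i\<in>UNIV. comm_dir i (Suc j * K) u n))"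
      by (simp only: One_nat_def sum.atLeast1_atMost_eq)
    finally show ?thesis .
  qed
  ultimately show ?thesis unfolding sums_def by (simp only:)
qed

text \<open>
  \<open>A\<^sub>p\<close> sends the unit vector at the origin to a combination of those at distance \<open>p\<close> on the
  coordinate axes; different \<open>p\<close> therefore do not interact.
\<close>

lemma A_fun_unit_at:
  fixes i :: "'d::finite"
  assumes "1 \<le> q"
  shows "A_fun p (unit_at 0) (axis i (int q)) = (if p = q then of_nat q / (4 * \<i>) else 0)"
proof -
  have N: "Npos l (unit_at 0) = (\<lambda>n. 0)" for l :: 'd
    by (auto simp: Npos_def unit_at_def fun_eq_iff)
  have z: "axis i a = 0 \<longleftrightarrow> a = 0" for a :: int
    by (auto simp: vec_eq_iff axis_def)
  have d: "axis i (int q) - axis i b = axis i (int q - b)" for b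
    using axis_add_int[of i "int q - b" b] by (simp add: algebra_simps)
  have inj: "axis i a = axis i b \<longleftrightarrow> a = b" for a b :: int by (auto simp: axis_eq_axis)
  have c: "axis i a $ i = a" for a :: int by (simp add: axis_def)
  have A: "A_dir_fun l p (unit_at 0) n
      = 1 / (4 * \<i>) * (of_int (n $ l) * (unit_at 0 (n - axis l (int p)) - unit_at 0 (n - axis l (- int p))))"
    for l :: 'd and n
    unfolding A_dir_fun_def N by (simp add: shift_diff_def shift_def Npos_def)
  have "A_dir_fun l p (unit_at 0) (axis i (int q)) =
      (if l = i then if p = q then of_nat q / (4 * \<i>) else 0 else 0)" for l
  proof (cases "l = i")
    case True
    then show ?thesis using assms
      by (auto simp: A unit_at_def d z c inj axis_add_int)
  next
    case False
    then show ?thesis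
      by (simp add: A axis_def)
  qed
  then show ?thesis by (simp add: A_fun_def)
qed

text \<open>
  The image of the unit vector at the origin has absolute value \<open>\<bar>\<rho>\<^bsub>jK\<^esub>\<bar> jK/4\<close> at the point at
  distance \<open>jK\<close> on a coordinate axis. As this image is square-summable, so is \<open>j \<rho>\<^bsub>jK\<^esub>\<close>, and then
  \<open>\<rho>\<^bsub>jK\<^esub>\<close> is summable, as a product with the square-summable \<open>1/j\<close>.
\<close>

lemma coefficients_summable:
  fixes H :: "('d::finite lattice_fun \<times> 'd lattice_fun) set"
  assumes sa: "selfadjoint_lin_comb K \<rho> H" and K: "1 \<le> K"
  shows "summable (\<lambda>j. \<bar>\<rho> (Suc j * K)\<bar>)"
proof -
  fix i :: 'd
  have "unit_at 0 \<in> Domain (lin_comb_core K \<rho> :: ('d lattice_fun \<times> 'd lattice_fun) set)"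
    using sa by (simp add: selfadjoint_lin_comb_def unit_at_comp_supp)
  then obtain v :: "'d lattice_fun" where v: "(unit_at 0, v) \<in> lin_comb_core K \<rho>" by (rule DomainE)
  let ?e = "\<lambda>j. axis i (int (Suc j * K)) :: int ^ 'd"
  have val: "v (?e q) = complex_of_real (\<rho> (Suc q * K)) * (of_nat (Suc q * K) / (4 * \<i>))" for q
  proof -
    have "(\<lambda>J. \<Sum>j=1..J. complex_of_real (\<rho> (j * K)) * A_fun (j * K) (unit_at 0) (?e q)) \<longlonglongrightarrow> v (?e q)"
      by (rule lin_comb_core_limit(3)[OF v])
    moreover have "(\<Sum>j=1..J. complex_of_real (\<rho> (j * K)) * A_fun (j * K) (unit_at 0) (?e q))
        = complex_of_real (\<rho> (Suc q * K)) * (of_nat (Suc q * K) / (4 * \<i>))" if "Suc q \<le> J" for J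
    proof -
      have "(\<Sum>j=1..J. complex_of_real (\<rho> (j * K)) * A_fun (j * K) (unit_at 0) (?e q))
          = (\<Sum>j=1..J. if j = Suc q then complex_of_real (\<rho> (Suc q * K)) * (of_nat (Suc q * K) / (4 * \<i>)) else 0)"
      proof (rule sum.cong[OF refl])
        fix j
        have "j * K = Suc q * K \<longleftrightarrow> j = Suc q" using K by (simp only: mult_cancel2) simp
        then show "complex_of_real (\<rho> (j * K)) * A_fun (j * K) (unit_at 0) (?e q)
          = (if j = Suc q then complex_of_real (\<rho> (Suc q * K)) * (of_nat (Suc q * K) / (4 * \<i>)) else 0)"
          using K by (subst A_fun_unit_at) auto
      qed
      then show ?thesis using that by simp
    qed
    then have "(\<lambda>J. \<Sum>j=1..J. complex_of_real (\<rho> (j * K)) * A_fun (j * K) (unit_at 0) (?e q)) \<longlonglongrightarrow>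
        complex_of_real (\<rho> (Suc q * K)) * (of_nat (Suc q * K) / (4 * \<i>))"
      by (intro tendsto_eventually eventually_sequentiallyI[of "Suc q"])
    ultimately show ?thesis by (rule LIMSEQ_unique)
  qed
  have inj: "inj ?e"
  proof (rule injI)
    fix a b assume "?e a = ?e b"
    then have "?e a $ i = ?e b $ i" by simp
    then have "Suc a * K = Suc b * K" by (simp only: axis_def vec_lambda_beta of_nat_eq_iff if_True simp_thms)
    then show "a = b" using K by (simp only: mult_cancel2) simp
  qed
  have "(\<lambda>n. (cmod (v n))\<^sup>2) summable_on (range ?e)"
    using lin_comb_core_limit(2)[OF v] unfolding ell2_def by (auto intro: summable_on_subset)
  then have "(\<lambda>q. (cmod (v (?e q)))\<^sup>2) summable_on UNIV"
    by (simp only: summable_on_reindex[OF inj] o_def)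
  then have s1: "summable (\<lambda>q. (cmod (v (?e q)))\<^sup>2)"
    by (rule summable_on_imp_summable)
  have s2: "summable (\<lambda>q. 16 * inverse ((real (Suc q))\<^sup>2))"
    by (intro summable_mult summable_Suc_iff[THEN iffD2, of "\<lambda>n. inverse ((real n)\<^sup>2)"]
        inverse_power_summable) simp
  show ?thesis
  proof (rule summable_comparison_test'[OF summable_add[OF s1 s2], of 0])
    fix q
    define a where "a = real (Suc q * K)"
    define b where "b = cmod (v (?e q))"
    have a: "real (Suc q) \<le> a" "0 < a" using K unfolding a_def by (simp_all del: of_nat_Suc mult_Suc)
    have b: "b = \<bar>\<rho> (Suc q * K)\<bar> * a / 4"
      unfolding b_def val a_def by (simp add: norm_mult norm_divide del: mult_Suc of_nat_mult)
    have "\<bar>\<rho> (Suc q * K)\<bar> = b * (4 / a)" using a by (simp add: b)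
    also have "\<dots> \<le> b\<^sup>2 + (4 / a)\<^sup>2"
    proof -
      have "0 \<le> b * (4 / a)" using a by (simp add: b_def)
      moreover have "2 * (b * (4 / a)) \<le> b\<^sup>2 + (4 / a)\<^sup>2"
        using sum_squares_bound[of b "4 / a"] by (simp only: mult.assoc)
      ultimately show ?thesis by linarith
    qed
    also have "(4 / a)\<^sup>2 \<le> (4 / real (Suc q))\<^sup>2"
      using a by (intro power_mono divide_left_mono) (auto simp del: of_nat_Suc)
    also have "\<dots> = 16 * inverse ((real (Suc q))\<^sup>2)"
      by (simp add: power_divide divide_inverse power_inverse del: of_nat_Suc)
    finally show "norm \<bar>\<rho> (Suc q * K)\<bar> \<le> (cmod (v (?e q)))\<^sup>2 + 16 * inverse ((real (Suc q))\<^sup>2)"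
      by (simp add: b_def)
  qed
qed

text \<open>
  The expectation of each term of the series has absolute value at most \<open>d \<bar>\<rho>\<^bsub>jK\<^esub>\<bar>\<close> uniformly in \<open>N\<close>,
  because the directional commutators are contractions; this is the summable majorant for Tannery's theorem.
\<close>

lemma commutator_symbol:
  fixes x :: "real ^ 'd::finite"
  assumes sa: "selfadjoint_lin_comb K \<rho> H" and B: "bounded_commutator MV_D H B" and K: "1 \<le> K"
    and x: "\<And>i. x $ i = cos (\<theta> i)"
  obtains G where "(\<lambda>j. \<rho> (Suc j * K) * g_fun (Suc j * K) x) sums G"
    and "(\<lambda>N. ell2_inner (weyl \<theta> N) (B (weyl \<theta> N))) \<longlonglongrightarrow> complex_of_real G"
proof -
  let ?c = "\<lambda>j. complex_of_real (\<rho> (Suc j * K))"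
  define a where "a j N = ?c j * - (\<Sum>i\<in>UNIV. ell2_inner (weyl \<theta> N) (comm_dir i (Suc j * K) (weyl \<theta> N)))" for j N
  define b where "b j = \<rho> (Suc j * K) * g_fun (Suc j * K) x" for j
  have inner: "(\<lambda>j. a j N) sums ell2_inner (weyl \<theta> N) (B (weyl \<theta> N))" for N
  proof -
    have "(\<lambda>j. \<Sum>n\<in>lattice_box N. cnj (weyl \<theta> N n) * (?c j * - (\<Sum>i\<in>UNIV. comm_dir i (Suc j * K) (weyl \<theta> N) n)))
        sums (\<Sum>n\<in>lattice_box N. cnj (weyl \<theta> N n) * B (weyl \<theta> N) n)"
      by (intro sums_sum sums_mult commutator_series[OF sa B weyl_comp_supp])
    moreover have "(\<Sum>n\<in>lattice_box N. cnj (weyl \<theta> N n) * (?c j * - (\<Sum>i\<in>UNIV. comm_dir i (Suc j * K) (weyl \<theta> N) n)))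
        = a j N" for j
    proof -
      have "(\<Sum>i\<in>UNIV. ell2_inner (weyl \<theta> N) (comm_dir i (Suc j * K) (weyl \<theta> N)))
          = (\<Sum>n\<in>lattice_box N. \<Sum>i\<in>UNIV. cnj (weyl \<theta> N n) * comm_dir i (Suc j * K) (weyl \<theta> N) n)"
        by (subst sum.swap) (simp only: comp_supp_inner[OF finite_lattice_box weyl_outside])
      then show ?thesis
        by (simp add: a_def sum_distrib_left sum_negf algebra_simps)
    qed
    ultimately show ?thesis
      by (simp add: comp_supp_inner[OF finite_lattice_box weyl_outside])
  qed
  have lim: "(\<lambda>N. a j N) \<longlonglongrightarrow> complex_of_real (b j)" for j
  proof -
    have p: "1 \<le> Suc j * K" using K by simp
    have "(\<lambda>N. a j N) \<longlonglongrightarrow> ?c j * - (\<Sum>i\<in>UNIV. - complex_of_real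
        ((\<Prod>l\<in>UNIV - {i}. cos (\<theta> l)) * sin (\<theta> i) * sin (real (Suc j * K) * \<theta> i)))"
      unfolding a_def
      by (intro tendsto_intros approx_eigen_inner approx_eigen_comm_dir weyl_ell2 weyl_norm)
    also have "?c j * - (\<Sum>i\<in>UNIV. - complex_of_real
        ((\<Prod>l\<in>UNIV - {i}. cos (\<theta> l)) * sin (\<theta> i) * sin (real (Suc j * K) * \<theta> i))) = complex_of_real (b j)"
      unfolding b_def g_fun_cos[of x \<theta>, OF x p] by (simp add: sum_negf del: mult_Suc)
    finally show ?thesis .
  qed
  have bound: "norm (a j N) \<le> \<bar>\<rho> (Suc j * K)\<bar> * real CARD('d)" for j N
  proof -
    have "norm (\<Sum>i\<in>UNIV. ell2_inner (weyl \<theta> N) (comm_dir i (Suc j * K) (weyl \<theta> N))) \<le> (\<Sum>i\<in>(UNIV::'d set). 1)"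
    proof (rule sum_norm_le)
      fix i
      have "norm (ell2_inner (weyl \<theta> N) (comm_dir i (Suc j * K) (weyl \<theta> N)))
          \<le> ell2_norm (weyl \<theta> N) * ell2_norm (comm_dir i (Suc j * K) (weyl \<theta> N))"
        by (intro ell2_Cauchy_Schwarz weyl_ell2 contraction_ell2[OF contraction_comm_dir])
      also have "\<dots> \<le> 1"
        using contraction_norm[OF contraction_comm_dir[of i "Suc j * K"] weyl_ell2[of \<theta> N]] by (simp add: weyl_norm)
      finally show "norm (ell2_inner (weyl \<theta> N) (comm_dir i (Suc j * K) (weyl \<theta> N))) \<le> 1" .
    qed
    then show ?thesis unfolding a_def norm_mult norm_minus_cancel norm_of_real
      by (intro mult_left_mono) auto
  qed
  have sm: "summable (\<lambda>j. \<bar>\<rho> (Suc j * K)\<bar> * real CARD('d))"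
    by (intro summable_mult2 coefficients_summable[OF sa K])
  have "eventually (\<lambda>N. summable (\<lambda>j. norm (a j N))) sequentially \<and>
      summable (\<lambda>j. norm (complex_of_real (b j))) \<and>
      (\<lambda>N. suminf (\<lambda>j. a j N)) \<longlonglongrightarrow> suminf (\<lambda>j. complex_of_real (b j))"
    by (rule tannerys_theorem[OF lim _ sm]) (use bound in \<open>auto simp: always_eventually\<close>)
  then have sb: "summable (\<lambda>j. norm (b j))"
    and tan: "(\<lambda>N. suminf (\<lambda>j. a j N)) \<longlonglongrightarrow> suminf (\<lambda>j. complex_of_real (b j))" by auto
  have bs: "b sums suminf b" using sb summable_norm_cancel summable_sums by blast
  then have "suminf (\<lambda>j. complex_of_real (b j)) = complex_of_real (suminf b)"
    using sums_of_real sums_unique by metis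
  moreover have "suminf (\<lambda>j. a j N) = ell2_inner (weyl \<theta> N) (B (weyl \<theta> N))" for N
    using sums_unique[OF inner] by simp
  ultimately have "(\<lambda>N. ell2_inner (weyl \<theta> N) (B (weyl \<theta> N))) \<longlonglongrightarrow> complex_of_real (suminf b)"
    using tan by simp
  then show ?thesis using that bs unfolding b_def by blast
qed

text \<open>
  The projections in the estimate may be dropped in the limit, since \<open>P I\<close> asymptotically fixes the
  approximate eigenvectors and \<open>B\<close> is bounded.
\<close>

lemma mourre_symbol_bound:
  fixes \<theta> :: "'d::finite \<Rightarrow> real" and B :: "'d lattice_fun \<Rightarrow> 'd lattice_fun"
  assumes E: "E = (\<Prod>l\<in>UNIV. cos (\<theta> l))" and B: "bounded_op B"
    and P: "spectral_measure MV_D P" and I: "open I" "E \<in> I"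
    and le: "op_le (\<lambda>u n. complex_of_real \<gamma> * P I u n) (\<lambda>u. P I (B (P I u)))"
    and G: "(\<lambda>N. ell2_inner (weyl \<theta> N) (B (weyl \<theta> N))) \<longlonglongrightarrow> complex_of_real G"
  shows "\<gamma> \<le> G"
proof -
  interpret spectral_resolution MV_D P
    by unfold_locales (use P contraction_MV_D in auto)
  have IB: "I \<in> sets borel" using I by simp
  obtain \<epsilon> where \<epsilon>: "0 < \<epsilon>" "\<And>t. \<bar>t - E\<bar> < \<epsilon> \<Longrightarrow> t \<in> I"
    using I unfolding open_real by (metis dist_real_def open_dist I)
  obtain C0 where C0: "\<And>u. u \<in> ell2 \<Longrightarrow> ell2_norm (B u) \<le> C0 * ell2_norm u"
    using B unfolding bounded_op_def by blast
  define C where "C = \<bar>C0\<bar>"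
  have C: "ell2_norm (B u) \<le> C * ell2_norm u" if "u \<in> ell2" for u
    using C0[OF that] mult_right_mono[OF abs_ge_self[of C0] ell2_norm_nonneg[of u]] unfolding C_def by linarith
  have B2: "B u \<in> ell2" if "u \<in> ell2" for u using B that by (simp add: bounded_op_def)
  let ?u = "weyl \<theta>" and ?w = "\<lambda>N. P I (weyl \<theta> N)"
  let ?e = "\<lambda>N n. ?u N n - ?w N n"
  have w: "?w N \<in> ell2" for N by (rule P_ell2[OF IB weyl_ell2])
  have e: "?e N \<in> ell2" for N by (rule ell2_diff[OF weyl_ell2 w])
  define \<delta> where "\<delta> N = ell2_norm (?e N)" for N
  have \<delta>: "\<delta> \<longlonglongrightarrow> 0"
  proof (rule Lim_null_comparison)
    let ?r = "\<lambda>N. ell2_norm (\<lambda>n. MV_D (?u N) n - complex_of_real E * ?u N n)"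
    have "(\<lambda>N. 2 / \<epsilon> * ?r N) \<longlonglongrightarrow> 2 / \<epsilon> * 0"
      unfolding E by (intro tendsto_mult tendsto_const weyl_energy_defect)
    then show "(\<lambda>N. 2 / \<epsilon> * ?r N) \<longlonglongrightarrow> 0" by simp
    have "\<delta> N \<le> 2 / \<epsilon> * ?r N" for N
      using P_localises[OF IB weyl_ell2[of \<theta> N] \<epsilon>] \<epsilon>(1) by (simp add: \<delta>_def field_simps)
    then show "\<forall>\<^sub>F N in sequentially. norm (\<delta> N) \<le> 2 / \<epsilon> * ?r N"
      by (simp add: \<delta>_def)
  qed
  \<comment> \<open>The operator inequality, tested on \<open>u\<^sub>N\<close>, with one projection moved to the left factor.\<close>
  have quad: "\<gamma> * Re (ell2_inner (?u N) (?w N)) \<le> Re (ell2_inner (?w N) (B (?w N)))" for N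
  proof -
    have "0 \<le> Re (ell2_inner (?u N) (P I (B (?w N))) - ell2_inner (?u N) (\<lambda>n. complex_of_real \<gamma> * ?w N n))"
      using le weyl_ell2[of \<theta> N] unfolding op_le_def by blast
    then show ?thesis
      by (simp add: ell2_inner_scale_right P_symmetric[OF IB weyl_ell2 B2[OF w]])
  qed
  have lw: "(\<lambda>N. ell2_inner (?u N) (?w N)) \<longlonglongrightarrow> 1"
  proof -
    have "(\<lambda>N. ell2_inner (?u N) (?w N) - 1) \<longlonglongrightarrow> 0"
    proof (rule Lim_null_comparison[OF _ \<delta>], intro always_eventually allI)
      fix N
      have "ell2_inner (?u N) (?e N) = 1 - ell2_inner (?u N) (?w N)"
        by (simp add: ell2_inner_diff_right weyl_ell2 w ell2_inner_self weyl_norm)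
      then show "norm (ell2_inner (?u N) (?w N) - 1) \<le> \<delta> N"
        using ell2_Cauchy_Schwarz[OF weyl_ell2[of \<theta> N] e[of N]] by (simp add: weyl_norm \<delta>_def norm_minus_commute)
    qed
    then show ?thesis by (rule LIM_zero_cancel)
  qed
  have lB: "(\<lambda>N. ell2_inner (?w N) (B (?w N))) \<longlonglongrightarrow> complex_of_real G"
  proof -
    have "(\<lambda>N. C * \<delta> N + \<delta> N * (C * (1 + \<delta> N))) \<longlonglongrightarrow> C * 0 + 0 * (C * (1 + 0))"
      by (intro tendsto_intros \<delta>)
    then have z: "(\<lambda>N. C * \<delta> N + \<delta> N * (C * (1 + \<delta> N))) \<longlonglongrightarrow> 0" by simp
    have "(\<lambda>N. ell2_inner (?u N) (B (?u N)) - ell2_inner (?w N) (B (?w N))) \<longlonglongrightarrow> 0"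
    proof (rule Lim_null_comparison[OF _ z], intro always_eventually allI)
      fix N
      have Be: "B (?e N) = (\<lambda>n. B (?u N) n - B (?w N) n)"
      proof -
        have "B (\<lambda>n. 1 * ?u N n + (-1) * ?w N n) = (\<lambda>n. 1 * B (?u N) n + (-1) * B (?w N) n)"
          using B weyl_ell2 w unfolding bounded_op_def by blast
        then show ?thesis by simp
      qed
      have "ell2_inner (?u N) (B (?e N)) + ell2_inner (?e N) (B (?w N))
          = ell2_inner (?u N) (B (?u N)) - ell2_inner (?w N) (B (?w N))"
        using ell2_inner_lincomb_left[OF weyl_ell2[of \<theta> N] w[of N] B2[OF w[of N]], of 1 "-1"]
        by (simp add: Be ell2_inner_diff_right weyl_ell2 w B2)
      moreover have "norm (ell2_inner (?u N) (B (?e N))) \<le> C * \<delta> N"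
        using ell2_Cauchy_Schwarz[OF weyl_ell2[of \<theta> N] B2[OF e[of N]]] C[OF e[of N]]
        by (simp add: weyl_norm \<delta>_def)
      moreover have "norm (ell2_inner (?e N) (B (?w N))) \<le> \<delta> N * (C * (1 + \<delta> N))"
      proof -
        have "ell2_norm (?w N) \<le> 1 + \<delta> N"
          using ell2_lincomb(2)[OF weyl_ell2[of \<theta> N] e[of N], of 1 "-1"] by (simp add: weyl_norm \<delta>_def)
        then have "ell2_norm (B (?w N)) \<le> C * (1 + \<delta> N)"
          using C[OF w[of N]] mult_left_mono[of "ell2_norm (?w N)" "1 + \<delta> N" C] by (simp add: C_def)
        then show ?thesis
          using ell2_Cauchy_Schwarz[OF e[of N] B2[OF w[of N]]]
            mult_left_mono[of "ell2_norm (B (?w N))" "C * (1 + \<delta> N)" "\<delta> N"]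
          by (simp add: \<delta>_def)
      qed
      ultimately show "norm (ell2_inner (?u N) (B (?u N)) - ell2_inner (?w N) (B (?w N)))
          \<le> C * \<delta> N + \<delta> N * (C * (1 + \<delta> N))"
        using norm_triangle_mono[of "ell2_inner (?u N) (B (?e N))" "C * \<delta> N"
            "ell2_inner (?e N) (B (?w N))" "\<delta> N * (C * (1 + \<delta> N))"] by (simp only:)
    qed
    from tendsto_diff[OF G this] show ?thesis by simp
  qed
  have "(\<lambda>N. \<gamma> * Re (ell2_inner (?u N) (?w N))) \<longlonglongrightarrow> \<gamma> * Re 1"
    by (intro tendsto_intros lw)
  moreover have "(\<lambda>N. Re (ell2_inner (?w N) (B (?w N)))) \<longlonglongrightarrow> Re (complex_of_real G)"
    by (intro tendsto_intros lB)
  ultimately have "\<gamma> * Re 1 \<le> Re (complex_of_real G)"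
    by (rule LIMSEQ_le) (intro exI allI impI quad)
  then show ?thesis by simp
qed

lemma S_energy_cos:
  fixes x :: "real ^ 'd::finite"
  assumes "x \<in> S_energy E"
  shows "x $ i = cos (arccos (x $ i))" "E = (\<Prod>l\<in>UNIV. cos (arccos (x $ l)))"
proof -
  have c: "cos (arccos (x $ l)) = x $ l" for l using assms by (auto simp: S_energy_def)
  show "x $ i = cos (arccos (x $ i))" by (simp add: c)
  show "E = (\<Prod>l\<in>UNIV. cos (arccos (x $ l)))" using assms by (simp add: c S_energy_def)
qed

text \<open>
  This replaces the functional calculus: positivity of the localised commutator is transferred to the
  scalar function that represents it.
\<close>

lemma mu_imp_symbol_positive:
  assumes "E \<in> mu TYPE('d::finite) K" and K: "1 \<le> K"
  obtains \<rho> where "\<And>x :: real ^ 'd. x \<in> S_energy E \<Longrightarrow>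
    \<exists>G>0. (\<lambda>j. \<rho> (Suc j * K) * g_fun (Suc j * K) x) sums G"
proof -
  obtain \<rho> and H :: "('d lattice_fun \<times> 'd lattice_fun) set" and B P I \<gamma> where
    sa: "selfadjoint_lin_comb K \<rho> H" and B: "bounded_commutator MV_D H B"
    and P: "spectral_measure MV_D P" and I: "open I" "E \<in> I" and \<gamma>: "0 < \<gamma>"
    and le: "op_le (\<lambda>u n. complex_of_real \<gamma> * P I u n) (\<lambda>u. P I (B (P I u)))"
    using assms(1) unfolding mu_def by blast
  show ?thesis
  proof (rule that)
    fix x :: "real ^ 'd" assume x: "x \<in> S_energy E"
    obtain G where G: "(\<lambda>j. \<rho> (Suc j * K) * g_fun (Suc j * K) x) sums G"
      "(\<lambda>N. ell2_inner (weyl (\<lambda>i. arccos (x $ i)) N) (B (weyl (\<lambda>i. arccos (x $ i)) N))) \<longlonglongrightarrow> complex_of_real G"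
      by (rule commutator_symbol[OF sa B K S_energy_cos(1)[OF x]])
    have "\<gamma> \<le> G"
      by (rule mourre_symbol_bound[OF S_energy_cos(2)[OF x] _ P I le G(2)])
        (use B in \<open>simp add: bounded_commutator_def\<close>)
    then show "\<exists>G>0. (\<lambda>j. \<rho> (Suc j * K) * g_fun (Suc j * K) x) sums G"
      using G(1) \<gamma> by (intro exI[of _ G]) auto
  qed
qed

lemma Theta_m_subset_multiple:
  assumes "1 \<le> \<alpha>"
  shows "Theta_m TYPE('d::finite) m \<kappa> \<subseteq> Theta_m TYPE('d) m (\<alpha> * \<kappa>)"
proof
  fix E assume E: "E \<in> Theta_m TYPE('d) m \<kappa>"
  have j: "1 \<le> j * \<alpha>" if "1 \<le> j" for j using assms that by simp
  have shrink: "j * (\<alpha> * \<kappa>) = (j * \<alpha>) * \<kappa>" for j by (simp only: mult.assoc)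
  show "E \<in> Theta_m TYPE('d) m (\<alpha> * \<kappa>)"
  proof (cases "m = 0")
    case True
    then obtain x :: "real ^ 'd" where "E \<in> {-1..1}" "x \<in> S_energy E" "\<forall>j\<ge>1. g_fun (j * \<kappa>) x = 0"
      using E by (auto simp: Theta_m_def)
    then show ?thesis
      using True j unfolding Theta_m_def shrink by auto
  next
    case False
    then obtain x :: "nat \<Rightarrow> real ^ 'd" and \<omega> :: "nat \<Rightarrow> real" where "E \<in> {-1..1}"
      "\<forall>q\<le>m. x q \<in> S_energy E" "\<forall>q<m. \<omega> q \<le> 0"
      and eq: "\<forall>j\<ge>1. g_fun (j * \<kappa>) (x m) = (\<Sum>q<m. \<omega> q * g_fun (j * \<kappa>) (x q))"
      using E by (auto simp: Theta_m_def)
    moreover have "\<forall>j\<ge>1. g_fun (j * (\<alpha> * \<kappa>)) (x m) = (\<Sum>q<m. \<omega> q * g_fun (j * (\<alpha> * \<kappa>)) (x q))"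
      unfolding shrink using eq j by simp
    ultimately show ?thesis
      using False unfolding Theta_m_def by (simp only: if_False mem_Collect_eq) blast
  qed
qed

lemma Theta_m_subset_Theta:
  assumes K: "1 \<le> K"
  shows "Theta_m TYPE('d::finite) m K \<subseteq> Theta TYPE('d) K"
proof
  fix E assume E: "E \<in> Theta_m TYPE('d) m K"
  obtain x :: "real ^ 'd" where "x \<in> S_energy E"
    using E by (auto simp: Theta_m_def split: if_splits)
  then have spec: "complex_of_real E \<in> spectrum_op (MV_D :: 'd lattice_fun \<Rightarrow> 'd lattice_fun)"
    by (rule energy_in_spectrum[OF S_energy_cos(2)])
  have "E \<notin> mu TYPE('d) K"
  proof
    assume "E \<in> mu TYPE('d) K"
    then obtain \<rho> where "\<forall>x :: real ^ 'd. x \<in> S_energy E \<longrightarrow>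
        (\<exists>G>0. (\<lambda>j. \<rho> (Suc j * K) * g_fun (Suc j * K) x) sums G)"
      using mu_imp_symbol_positive[OF _ K] by metis
    then obtain G where G: "\<And>x :: real ^ 'd. x \<in> S_energy E \<Longrightarrow> 0 < G x"
      "\<And>x :: real ^ 'd. x \<in> S_energy E \<Longrightarrow> (\<lambda>j. \<rho> (Suc j * K) * g_fun (Suc j * K) x) sums G x"
      by metis
    show False
    proof (cases "m = 0")
      case True
      then obtain y :: "real ^ 'd" where y: "y \<in> S_energy E" "\<forall>j\<ge>1. g_fun (j * K) y = 0"
        using E by (auto simp: Theta_m_def)
      have "g_fun (Suc j * K) y = 0" for j using y(2) by (simp del: mult_Suc)
      then have "(\<lambda>j. 0) sums G y" using G(2)[OF y(1)] by (simp del: mult_Suc)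
      then show False using G(1)[OF y(1)] sums_unique2[OF sums_zero] by fastforce
    next
      case False
      then obtain X :: "nat \<Rightarrow> real ^ 'd" and \<omega> :: "nat \<Rightarrow> real" where
        X: "\<forall>q\<le>m. X q \<in> S_energy E" and \<omega>: "\<forall>q<m. \<omega> q \<le> 0"
        and eq: "\<forall>j\<ge>1. g_fun (j * K) (X m) = (\<Sum>q<m. \<omega> q * g_fun (j * K) (X q))"
        using E by (auto simp: Theta_m_def)
      have "(\<lambda>j. \<Sum>q<m. \<omega> q * (\<rho> (Suc j * K) * g_fun (Suc j * K) (X q))) sums (\<Sum>q<m. \<omega> q * G (X q))"
        by (intro sums_sum sums_mult G(2)) (use X in auto)
      moreover have "(\<Sum>q<m. \<omega> q * (\<rho> (Suc j * K) * g_fun (Suc j * K) (X q)))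
          = \<rho> (Suc j * K) * g_fun (Suc j * K) (X m)" for j
        using eq[rule_format, of "Suc j"] by (simp add: sum_distrib_left algebra_simps del: mult_Suc)
      ultimately have "(\<Sum>q<m. \<omega> q * G (X q)) = G (X m)"
        using sums_unique2[OF _ G(2)[of "X m"]] X by simp
      moreover have "(\<Sum>q<m. \<omega> q * G (X q)) \<le> 0"
        by (intro sum_nonpos mult_nonpos_nonneg) (use \<omega> X G(1) in \<open>auto intro: less_imp_le\<close>)
      moreover have "0 < G (X m)" using X by (intro G(1)) simp
      ultimately show False by linarith
    qed
  qed
  with spec show "E \<in> Theta TYPE('d) K" by (simp add: Theta_def)
qed

theorem lemma1p2:
  fixes \<kappa> :: nat
  assumes "\<kappa> \<ge> 1"
  shows "\<forall>m :: nat. \<forall>\<alpha> :: nat. \<alpha> \<ge> 1 \<longrightarrow>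
           Theta_m TYPE('d::finite) m \<kappa> \<subseteq> Theta_m TYPE('d) m (\<alpha> * \<kappa>) \<and>
           Theta_m TYPE('d) m (\<alpha> * \<kappa>) \<subseteq> Theta TYPE('d) (\<alpha> * \<kappa>)"
proof (intro allI impI conjI)
  fix m \<alpha> :: nat
  assume \<alpha>: "\<alpha> \<ge> 1"
  show "Theta_m TYPE('d) m \<kappa> \<subseteq> Theta_m TYPE('d) m (\<alpha> * \<kappa>)"
    by (rule Theta_m_subset_multiple[OF \<alpha>])
  have "1 \<le> \<alpha> * \<kappa>" using \<alpha> assms by simp
  then show "Theta_m TYPE('d) m (\<alpha> * \<kappa>) \<subseteq> Theta TYPE('d) (\<alpha> * \<kappa>)"
    by (rule Theta_m_subset_Theta)
qed

end
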